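(* Let $T\in\mathcal{BC}(X)$, $m\in\mathbb N_0$, and let $U\subset\mathbb H$ be a bounded slice Cauchy domain with $\sigma_S(T)\subset U$. Then for every $J\in\mathbb S$, $$H_m(T)=\frac1{2\pi}\int_{\partial(U\cap\mathbb C_J)}\mathcal Q_{c,s}(T)^{-1}\,ds_J\,s^{m+1},\qquad\text{where } H_m(T):=\sum_{k=0}^mT^{m-k}\bar T^k.$$
   Context: $\mathbb H$ denotes the quaternions with units $e_1,e_2,e_3$; $\mathbb S$ is the sphere of unit purely imaginary quaternions and $\mathbb C_J=\{u+Jv:u,v\in\mathbb R\}$. $X=X_{\mathbb R}\otimes\mathbb H$ is a two-sided quaternionic Banach module over a real Banach space $X_{\mathbb R}$; $\mathcal{BC}(X)$ is the set of $T=T_0+T_1e_1+T_2e_2+T_3e_3$ with $T_i\in\mathcal B(X_{\mathbb R})$ pairwise commuting; $\bar T=T_0-\sum T_ie_i$; $\mathcal Q_{c,s}(T)=s^2\mathcal I-s(T+\bar T)+T\bar T$; $\sigma_S(T)$ is the set of $s$ for which $\mathcal Q_{c,s}(T)$ has no bounded inverse. A slice Cauchy domain is an axially symmetric open set $U$ (i.e. $u+Iv\in U$ implies $u+Jv\in U$ for all $J\in\mathbb S$) such that for each $J$ the boundary of $U\cap\mathbb C_J$ is a finite union of nonintersecting piecewise $C^1$ Jordan curves. Integrals are over positively oriented boundaries with $ds_J=ds(-J)$. *)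

theory Defs
  imports "HOL-Analysis.Analysis" "HOL-Complex_Analysis.Complex_Analysis"
begin

text \<open>A quaternion a0 + a1 e1 + a2 e2 + a3 e3 is represented by its four real
coordinates; the Euclidean structure of the product type is the usual one on H.\<close>

type_synonym quat = "real \<times> real \<times> real \<times> real"

text \<open>Generic quaternion-type product, parametrised by the scalar pairing m.
  With m = (*) this is the quaternion product; with m = scaleR it is left
  multiplication of an element of X = X_R (x) H by a quaternion; with
  m = blinfun_apply it is the action of T0 + T1 e1 + T2 e2 + T3 e3 on X.\<close>

definition qprod :: "('a \<Rightarrow> 'b \<Rightarrow> 'c::ab_group_add) \<Rightarrow> 'a \<times> 'a \<times> 'a \<times> 'a
     \<Rightarrow> 'b \<times> 'b \<times> 'b \<times> 'b \<Rightarrow> 'c \<times> 'c \<times> 'c \<times> 'c" where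
  "qprod m a b = (case a of (a0, a1, a2, a3) \<Rightarrow> case b of (b0, b1, b2, b3) \<Rightarrow>
     (m a0 b0 - m a1 b1 - m a2 b2 - m a3 b3,
      m a0 b1 + m a1 b0 + m a2 b3 - m a3 b2,
      m a0 b2 - m a1 b3 + m a2 b0 + m a3 b1,
      m a0 b3 + m a1 b2 - m a2 b1 + m a3 b0))"

definition qmult :: "quat \<Rightarrow> quat \<Rightarrow> quat" where
  "qmult p q = qprod (*) p q"

definition qone :: quat where "qone = (1, 0, 0, 0)"

definition qpow :: "quat \<Rightarrow> nat \<Rightarrow> quat" where
  "qpow q n = (qmult q ^^ n) qone"

definition imag_units :: "quat set" where
  "imag_units = {(a0, a1, a2, a3). a0 = 0 \<and> a1\<^sup>2 + a2\<^sup>2 + a3\<^sup>2 = 1}"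

definition cJ :: "quat \<Rightarrow> complex \<Rightarrow> quat" where
  "cJ J z = (Re z, 0, 0, 0) + Im z *\<^sub>R J"

definition CJ :: "quat \<Rightarrow> quat set" where
  "CJ J = range (cJ J)"

definition axially_symmetric :: "quat set \<Rightarrow> bool" where
  "axially_symmetric U \<longleftrightarrow>
     (\<forall>I\<in>imag_units. \<forall>J\<in>imag_units. \<forall>u v.
        (u, 0, 0, 0) + v *\<^sub>R I \<in> U \<longrightarrow> (u, 0, 0, 0) + v *\<^sub>R J \<in> U)"

text \<open>U \<inter> C_J transported to the complex plane.\<close>
definition slice_set :: "quat \<Rightarrow> quat set \<Rightarrow> complex set" where
  "slice_set J U = cJ J -` U"

definition jordan_boundary :: "quat \<Rightarrow> quat set \<Rightarrow> (real \<Rightarrow> complex) list \<Rightarrow> bool" where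
  "jordan_boundary J U gs \<longleftrightarrow>
     (\<forall>g\<in>set gs. simple_path g \<and> valid_path g \<and> pathfinish g = pathstart g) \<and>
     (\<forall>i<length gs. \<forall>j<length gs. i \<noteq> j \<longrightarrow>
        path_image (gs ! i) \<inter> path_image (gs ! j) = {}) \<and>
     (\<Union>g\<in>set gs. path_image g) = frontier (slice_set J U)"

definition slice_cauchy_domain :: "quat set \<Rightarrow> bool" where
  "slice_cauchy_domain U \<longleftrightarrow> open U \<and> axially_symmetric U \<and>
     (\<forall>J\<in>imag_units. \<exists>gs. jordan_boundary J U gs)"

definition pos_oriented_boundary :: "quat \<Rightarrow> quat set \<Rightarrow> (real \<Rightarrow> complex) list \<Rightarrow> bool" where
  "pos_oriented_boundary J U gs \<longleftrightarrow> jordan_boundary J U gs \<and>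
     (\<forall>z. z \<notin> frontier (slice_set J U) \<longrightarrow>
        (\<Sum>g\<leftarrow>gs. winding_number g z) = (if z \<in> slice_set J U then 1 else 0))"

text \<open>X = X_R (x) H is represented as X_R^4; T = T0 + T1 e1 + T2 e2 + T3 e3 by
  the quadruple of its real components.\<close>

type_synonym 'x qmod = "'x \<times> 'x \<times> 'x \<times> 'x"
type_synonym 'x qop = "('x \<Rightarrow>\<^sub>L 'x) \<times> ('x \<Rightarrow>\<^sub>L 'x) \<times> ('x \<Rightarrow>\<^sub>L 'x) \<times> ('x \<Rightarrow>\<^sub>L 'x)"

definition in_BC :: "'x::real_normed_vector qop \<Rightarrow> bool" where
  "in_BC T = (case T of (T0, T1, T2, T3) \<Rightarrow>
     (\<forall>A\<in>{T0, T1, T2, T3}. \<forall>B\<in>{T0, T1, T2, T3}. A o\<^sub>L B = B o\<^sub>L A))"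

definition opact :: "'x::real_normed_vector qop \<Rightarrow> 'x qmod \<Rightarrow>\<^sub>L 'x qmod" where
  "opact T = Blinfun (qprod blinfun_apply T)"

definition lmult :: "quat \<Rightarrow> 'x::real_normed_vector qmod \<Rightarrow>\<^sub>L 'x qmod" where
  "lmult q = Blinfun (qprod scaleR q)"

definition conjop :: "'x::real_normed_vector qop \<Rightarrow> 'x qop" where
  "conjop T = (case T of (T0, T1, T2, T3) \<Rightarrow> (T0, - T1, - T2, - T3))"

definition bpow :: "('a::real_normed_vector \<Rightarrow>\<^sub>L 'a) \<Rightarrow> nat \<Rightarrow> 'a \<Rightarrow>\<^sub>L 'a" where
  "bpow A n = ((\<lambda>B. A o\<^sub>L B) ^^ n) id_blinfun"

definition Qcs :: "'x::real_normed_vector qop \<Rightarrow> quat \<Rightarrow> 'x qmod \<Rightarrow>\<^sub>L 'x qmod" where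
  "Qcs T s = lmult (qmult s s) - (lmult s o\<^sub>L (opact T + opact (conjop T)))
             + (opact T o\<^sub>L opact (conjop T))"

definition S_spectrum :: "'x::real_normed_vector qop \<Rightarrow> quat set" where
  "S_spectrum T = {s. \<not> (\<exists>B. B o\<^sub>L Qcs T s = id_blinfun \<and> Qcs T s o\<^sub>L B = id_blinfun)}"

definition Qinv :: "'x::real_normed_vector qop \<Rightarrow> quat \<Rightarrow> 'x qmod \<Rightarrow>\<^sub>L 'x qmod" where
  "Qinv T s = (THE B. B o\<^sub>L Qcs T s = id_blinfun \<and> Qcs T s o\<^sub>L B = id_blinfun)"

definition Hm :: "'x::real_normed_vector qop \<Rightarrow> nat \<Rightarrow> 'x qmod \<Rightarrow>\<^sub>L 'x qmod" where
  "Hm T m = (\<Sum>k=0..m. bpow (opact T) (m - k) o\<^sub>L bpow (opact (conjop T)) k)"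

text \<open>Integrand of  Q_{c,s}(T)^{-1} ds_J s^{m+1}  along a path g in C, with
  s = cJ J (g t), ds = cJ J (g'(t)) dt and ds_J = ds (-J).\<close>
definition slice_integrand ::
  "'x::real_normed_vector qop \<Rightarrow> nat \<Rightarrow> quat \<Rightarrow> (real \<Rightarrow> complex) \<Rightarrow> real \<Rightarrow> 'x qmod \<Rightarrow>\<^sub>L 'x qmod" where
  "slice_integrand T m J g t =
     Qinv T (cJ J (g t)) o\<^sub>L
       lmult (qmult (qmult (cJ J (vector_derivative g (at t))) (- J)) (qpow (cJ J (g t)) (Suc m)))"

end

(* With A = T and B its conjugate, S = A + B and N = A B commute with each other and with left
   multiplication by the slice C_J, so on a slice Q_{c,s}(T) is a quadratic pencil
   s^2 - s S + N with resolvent R.  Let D, E be the integrals of R(w) and w R(w).  As in Dixon's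
   proof of Cauchy's theorem, the integral of R(w)/(w - z), which is holomorphic inside the
   contour, equals there R(z)(2 pi i - E - (z - S) D), an expression holomorphic off the
   spectrum.  The two glue to an entire function vanishing at infinity, so D = 0 and
   E = 2 pi i.  The higher moments follow because H_m satisfies the recursion
   H_{m+2} = S H_{m+1} - N H_m. *)
theory Submission
  imports Defs
begin

section \<open>Holomorphic functions with values in a Banach space\<close>

text \<open>Two obstacles shape the proof. The boundary is a cycle of which only the winding numbers
  are known, and the operators form a complex space only through a slice: z acts by left composition
  with \<open>lmult (cJ J z)\<close>, which depends on J. Holomorphy is therefore developed for an
  arbitrary action of the complex numbers on a real Banach space, and Liouville's theorem replaces
  any deformation of the cycle into a large circle. The product R(z)(2 pi i - E - (z - S) D) comes
  from the resolvent identity, in which R(w) - R(z) has the exact factor w - z. It tends to 0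
  because R(z) decays like |z|^-2 while the bracket is affine in z; and an affine function that
  vanishes at all large z has zero coefficients. T itself need not commute with left multiplication
  by the slice. Only the two combinations free of imaginary units do: the sum 2 T0 of T and its
  conjugate, and their product T0^2 + T1^2 + T2^2 + T3^2.\<close>

locale complex_scaling = bounded_bilinear cs
  for cs :: "complex \<Rightarrow> 'b::banach \<Rightarrow> 'b" (infixr "\<star>" 75) +
  assumes cs_one: "1 \<star> x = x"
    and cs_mult: "(a * b) \<star> x = a \<star> b \<star> x"
begin

lemma cs_commute: "a \<star> b \<star> x = b \<star> a \<star> x"
  by (metis cs_mult mult.commute)

lemma cs_cancel: "a \<noteq> 0 \<Longrightarrow> a \<star> x = 0 \<longleftrightarrow> x = 0"
  by (metis cs_mult cs_one left_inverse zero_right)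

text \<open>Continuity of the derivative is built in, so that differentiation under the integral
  sign applies at once and no argument of Goursat type is required. The derivative is taken at z in
  the full plane, so the notion is meant for open sets.\<close>

definition hol_on :: "(complex \<Rightarrow> 'b) \<Rightarrow> complex set \<Rightarrow> bool" where
  "hol_on f S \<longleftrightarrow>
     (\<exists>f'. continuous_on S f' \<and> (\<forall>z\<in>S. (f has_derivative (\<lambda>h. h \<star> f' z)) (at z)))"

lemma hol_onI:
  assumes "continuous_on S f'" "\<And>z. z \<in> S \<Longrightarrow> (f has_derivative (\<lambda>h. h \<star> f' z)) (at z)"
  shows "hol_on f S"
  using assms unfolding hol_on_def by blast

lemma hol_on_subset: "hol_on f S \<Longrightarrow> T \<subseteq> S \<Longrightarrow> hol_on f T"
  unfolding hol_on_def using continuous_on_subset by blast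

lemma hol_on_imp_continuous_on: "hol_on f S \<Longrightarrow> continuous_on S f"
  unfolding hol_on_def
  by (auto intro!: continuous_at_imp_continuous_on intro: has_derivative_continuous)

lemma hol_on_const [simp]: "hol_on (\<lambda>_. v) S"
  by (rule hol_onI[where f' = "\<lambda>_. 0"]) (auto simp: zero_right)

lemma hol_on_add:
  assumes "hol_on f S" "hol_on g S"
  shows "hol_on (\<lambda>z. f z + g z) S"
proof -
  obtain f' g' where "continuous_on S f'" "\<And>z. z \<in> S \<Longrightarrow> (f has_derivative (\<lambda>h. h \<star> f' z)) (at z)"
    "continuous_on S g'" "\<And>z. z \<in> S \<Longrightarrow> (g has_derivative (\<lambda>h. h \<star> g' z)) (at z)"
    using assms unfolding hol_on_def by blast
  then show ?thesis
    by (intro hol_onI[where f' = "\<lambda>z. f' z + g' z"])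
      (auto intro!: derivative_eq_intros continuous_intros simp: add_right)
qed

lemma hol_on_sum_list:
  assumes "\<And>g. g \<in> set gs \<Longrightarrow> hol_on (f g) S"
  shows "hol_on (\<lambda>z. \<Sum>g\<leftarrow>gs. f g z) S"
  using assms by (induction gs) (auto intro: hol_on_add)

lemma hol_on_cs:
  assumes "\<phi> holomorphic_on S" "hol_on f S" "open S"
  shows "hol_on (\<lambda>z. \<phi> z \<star> f z) S"
proof -
  obtain f' where f': "continuous_on S f'" "\<And>z. z \<in> S \<Longrightarrow> (f has_derivative (\<lambda>h. h \<star> f' z)) (at z)"
    using assms unfolding hol_on_def by blast
  have "continuous_on S \<phi>" "continuous_on S (deriv \<phi>)"
    using assms by (auto intro: holomorphic_on_imp_continuous_on holomorphic_deriv)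
  moreover have "(\<phi> has_derivative (\<lambda>h. h * deriv \<phi> z)) (at z)" if "z \<in> S" for z
    using holomorphic_derivI[OF assms(1,3) that] unfolding has_field_derivative_def
    by (rule has_derivative_eq_rhs) (simp add: fun_eq_iff mult.commute)
  ultimately show ?thesis using f' hol_on_imp_continuous_on[OF assms(2)]
    by (intro hol_onI[where f' = "\<lambda>z. \<phi> z \<star> f' z + deriv \<phi> z \<star> f z"])
      (auto intro!: continuous_on FDERIV[THEN has_derivative_eq_rhs] continuous_on_add
        simp: add_right cs_mult cs_commute)
qed

section \<open>Differentiation under the integral sign and local primitives\<close>

lemma has_derivative_integral_param:
  assumes U: "open U" "z0 \<in> U"
    and der: "\<And>z t. z \<in> U \<Longrightarrow> t \<in> {0..1::real} \<Longrightarrow> ((\<lambda>z. f z t) has_derivative (\<lambda>h. h \<star> f' z t)) (at z)"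
    and cf: "\<And>z. z \<in> U \<Longrightarrow> continuous_on {0..1} (f z)"
    and cf': "continuous_on (U \<times> {0..1}) (\<lambda>(z, t). f' z t)"
  shows "((\<lambda>z. integral {0..1} (f z)) has_derivative (\<lambda>h. h \<star> integral {0..1} (f' z0))) (at z0)"
proof -
  \<comment> \<open>A ball, because \<open>leibniz_rule\<close> asks for a convex domain.\<close>
  obtain e where e: "e > 0" "ball z0 e \<subseteq> U" using U open_contains_ball by blast
  have c: "continuous_on (ball z0 e \<times> {0..1}) (\<lambda>(z, t). f' z t)"
    by (rule continuous_on_subset[OF cf']) (use e in auto)
  \<comment> \<open>\<open>prod_left v\<close> is the bounded linear map h \<mapsto> h \<star> v;
    \<open>leibniz_rule\<close> expects the derivative in this form.\<close>
  have "continuous_on (ball z0 e \<times> {0..1}) (\<lambda>x. prod_left (case x of (z, t) \<Rightarrow> f' z t))"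
    by (rule bounded_linear.continuous_on[OF bounded_linear_prod_left c])
  then have c': "continuous_on (ball z0 e \<times> cbox 0 1) (\<lambda>(z, t). prod_left (f' z t))"
    by (simp add: split_beta)
  have "continuous_on {0..1} (\<lambda>t. f' z0 t)"
    using e continuous_on_compose2[OF c, of "{0..1}" "\<lambda>t. (z0, t)"]
    by (force intro: continuous_on_Pair continuous_on_const continuous_on_id)
  then have i: "f' z0 integrable_on {0..1}" by (rule integrable_continuous_interval)
  have "((\<lambda>z. integral (cbox 0 1) (f z)) has_derivative integral (cbox 0 1) (\<lambda>t. prod_left (f' z0 t)))
      (at z0 within ball z0 e)"
  proof (rule leibniz_rule[OF _ _ c'])
    fix z t assume zt: "z \<in> ball z0 e" "t \<in> cbox 0 (1::real)"
    then have "z \<in> U" using e by auto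
    then show "((\<lambda>z. f z t) has_derivative (prod_left (f' z t))) (at z within ball z0 e)"
      using der[of z t] zt by (auto intro: has_derivative_at_withinI)
  next
    fix z assume "z \<in> ball z0 e"
    then have "z \<in> U" using e by auto
    then show "f z integrable_on cbox 0 1"
      using cf[of z] by (auto intro: integrable_continuous_interval)
  qed (use e in auto)
  moreover have "integral {0..1} (\<lambda>t. prod_left (f' z0 t)) = prod_left (integral {0..1} (f' z0))"
    using integral_linear[OF i bounded_linear_prod_left] by (simp add: o_def)
  moreover have "at z0 within ball z0 e = at z0" using e(1) by (intro at_within_open) auto
  ultimately show ?thesis by simp
qed

definition line_int :: "(complex \<Rightarrow> 'b) \<Rightarrow> complex \<Rightarrow> complex \<Rightarrow> 'b" where
  "line_int f a b = (b - a) \<star> integral {0..1} (\<lambda>t. f (a + t *\<^sub>R (b - a)))"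

lemma line_int_refl [simp]: "line_int f a a = 0"
  by (simp add: line_int_def zero_left)

text \<open>Cauchy's theorem on a convex set, without triangles: differentiating (z - a) \<phi>(z)
  under the integral gives the integral over t of f + t (z - a) f' along the segment, and this
  integrand is the t-derivative of t f(a + t (z - a)), whose increment over [0, 1] is f(z).\<close>

lemma has_derivative_line_int:
  assumes S: "open S" "convex S" "a \<in> S" "z \<in> S" and f: "hol_on f S"
  shows "(line_int f a has_derivative (\<lambda>h. h \<star> f z)) (at z)"
proof -
  obtain f' where cf': "continuous_on S f'"
    and der: "\<And>z. z \<in> S \<Longrightarrow> (f has_derivative (\<lambda>h. h \<star> f' z)) (at z)"
    using f unfolding hol_on_def by blast
  note cf = hol_on_imp_continuous_on[OF f]
  have seg: "a + t *\<^sub>R (z - a) \<in> S" if "z \<in> S" "t \<in> {0..1}" for z t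
    using convexD_alt[OF S(2,3) that(1), of t] that by (simp add: algebra_simps)
  define \<phi> where "\<phi> z = integral {0..1} (\<lambda>t. f (a + t *\<^sub>R (z - a)))" for z
  define \<psi> where "\<psi> = integral {0..1} (\<lambda>t. t *\<^sub>R f' (a + t *\<^sub>R (z - a)))"
  have c1: "continuous_on {0..1} (\<lambda>t. f (a + t *\<^sub>R (z - a)))" if "z \<in> S" for z
    by (rule continuous_on_compose2[OF cf]) (use seg that in \<open>auto intro!: continuous_intros\<close>)
  have c2: "continuous_on (S \<times> {0..1}) (\<lambda>(z, t). t *\<^sub>R f' (a + t *\<^sub>R (z - a)))"
    unfolding split_beta
    by (intro continuous_intros continuous_on_compose2[OF cf']) (use seg in auto)
  have c3: "continuous_on {0..1} (\<lambda>t. t *\<^sub>R f' (a + t *\<^sub>R (z - a)))"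
    by (intro continuous_intros continuous_on_compose2[OF cf']) (use seg S in auto)
  have \<phi>: "(\<phi> has_derivative (\<lambda>h. h \<star> \<psi>)) (at z)"
    unfolding \<phi>_def \<psi>_def
  proof (rule has_derivative_integral_param[OF S(1,4) _ c1 c2])
    fix z t assume zt: "z \<in> S" "t \<in> {0..1::real}"
    have "((\<lambda>z. f (a + t *\<^sub>R (z - a))) has_derivative (\<lambda>h. (t *\<^sub>R h) \<star> f' (a + t *\<^sub>R (z - a)))) (at z)"
      by (rule has_derivative_compose[where g = f, OF _ der])
        (auto intro!: derivative_eq_intros seg zt)
    then show "((\<lambda>z. f (a + t *\<^sub>R (z - a))) has_derivative (\<lambda>h. h \<star> t *\<^sub>R f' (a + t *\<^sub>R (z - a)))) (at z)"
      by (simp add: scaleR_left scaleR_right)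
  qed auto
  have "((\<lambda>t. t *\<^sub>R f (a + t *\<^sub>R (z - a))) has_vector_derivative
      f (a + t *\<^sub>R (z - a)) + (z - a) \<star> t *\<^sub>R f' (a + t *\<^sub>R (z - a))) (at t within {0..1})"
    if t: "t \<in> {0..1}" for t
  proof -
    have "((\<lambda>t. f (a + t *\<^sub>R (z - a))) has_derivative (\<lambda>h. (h *\<^sub>R (z - a)) \<star> f' (a + t *\<^sub>R (z - a)))) (at t within {0..1})"
      by (rule has_derivative_compose[where g = f, OF _ der])
        (auto intro!: derivative_eq_intros seg S t)
    then show ?thesis unfolding has_vector_derivative_def
      by (auto intro!: derivative_eq_intros
          simp: scaleR_left scaleR_right scaleR_add_right mult.commute)
  qed
  then have "((\<lambda>t. f (a + t *\<^sub>R (z - a)) + (z - a) \<star> t *\<^sub>R f' (a + t *\<^sub>R (z - a))) has_integral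
     1 *\<^sub>R f (a + 1 *\<^sub>R (z - a)) - 0 *\<^sub>R f (a + 0 *\<^sub>R (z - a))) {0..1}"
    by (intro fundamental_theorem_of_calculus) auto
  moreover have "((\<lambda>t. f (a + t *\<^sub>R (z - a)) + (z - a) \<star> t *\<^sub>R f' (a + t *\<^sub>R (z - a))) has_integral
     \<phi> z + (z - a) \<star> \<psi>) {0..1}"
    unfolding \<phi>_def \<psi>_def
    by (intro has_integral_add integrable_integral
        has_integral_linear[OF integrable_integral bounded_linear_right, unfolded o_def]
        integrable_continuous_interval c1 c3 S)
  ultimately have eq: "\<phi> z + (z - a) \<star> \<psi> = f z"
    by (auto dest: has_integral_unique)
  have "((\<lambda>z. (z - a) \<star> \<phi> z) has_derivative (\<lambda>h. (z - a) \<star> h \<star> \<psi> + h \<star> \<phi> z)) (at z)"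
    by (rule FDERIV[OF _ \<phi>]) (auto intro!: derivative_eq_intros)
  moreover have "(\<lambda>h. (z - a) \<star> h \<star> \<psi> + h \<star> \<phi> z) = (\<lambda>h. h \<star> f z)"
    by (simp add: eq[symmetric] add_right cs_commute add.commute)
  ultimately show ?thesis by (simp add: line_int_def[abs_def] \<phi>_def)
qed

text \<open>The derivative of a valid path may be unbounded near finitely many points, so that a merely
  continuous integrand need not be integrable.  A holomorphic one is, through its local
  primitives, and its integral is then a sum of integrals over the segments of an inscribed
  polygon, where the same polygon serves every integrand.\<close>

lemma path_integral_polygon:
  assumes g: "valid_path g" "path_image g \<subseteq> S" and S: "open S"
  obtains n \<tau> where
    "\<And>k. k < n \<Longrightarrow> closed_segment (g (\<tau> k)) (g (\<tau> (Suc k))) \<subseteq> S"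
    "\<And>f. hol_on f S \<Longrightarrow> ((\<lambda>t. vector_derivative g (at t) \<star> f (g t)) has_integral
        (\<Sum>k<n. line_int f (g (\<tau> k)) (g (\<tau> (Suc k))))) {0..1}"
proof -
  have pg: "path g" using g by (rule_tac valid_path_imp_path)
  then have cg: "continuous_on {0..1} g" by (simp add: path_def)
  \<comment> \<open>One radius for all points of the path: each ball about an image point stays in
    S, and being convex it carries a primitive of every holomorphic f.\<close>
  obtain e where e: "e > 0" "\<And>x. x \<in> path_image g \<Longrightarrow> ball x e \<subseteq> S"
    by (rule compact_subset_open_imp_ball_epsilon_subset[OF compact_path_image[OF pg] S g(2)]) auto
  have "uniformly_continuous_on {0..1} g"
    using cg compact_uniformly_continuous by blast
  then obtain d where d: "d > 0"
      "\<And>x y. x \<in> {0..1} \<Longrightarrow> y \<in> {0..1} \<Longrightarrow> dist y x < d \<Longrightarrow> dist (g y) (g x) < e"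
    using e(1) unfolding uniformly_continuous_on_def by (elim allE[of _ e]) auto
  \<comment> \<open>With mesh 1/n < d each piece of the path stays in the ball about its left end
    point. The subdivision depends on g and S only, not on f.\<close>
  obtain n where n: "n > 0" "1 / real n < d"
    using real_arch_inverse d(1) by (metis inverse_eq_divide neq0_conv)
  define \<tau> where "\<tau> k = real k / real n" for k
  have \<tau>: "\<tau> k \<in> {0..1}" if "k \<le> n" for k using that n by (auto simp: \<tau>_def)
  have mono: "\<tau> k \<le> \<tau> (Suc k)" for k by (simp add: \<tau>_def divide_right_mono)
  have inball: "g t \<in> ball (g (\<tau> k)) e" if "k < n" "t \<in> {\<tau> k..\<tau> (Suc k)}" for k t
  proof -
    have "\<tau> (Suc k) - \<tau> k = 1 / real n" using n by (simp add: \<tau>_def field_simps)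
    then have "dist t (\<tau> k) < d" using that n by (auto simp: dist_real_def)
    moreover have "t \<in> {0..1}" using \<tau>[of k] \<tau>[of "Suc k"] that by auto
    ultimately show ?thesis using d(2)[of "\<tau> k" t] \<tau>[of k] that by (simp add: dist_commute)
  qed
  have ball: "ball (g (\<tau> k)) e \<subseteq> S" if "k < n" for k
    using e(2)[of "g (\<tau> k)"] \<tau>[of k] that by (auto simp: path_image_def)
  obtain F where F: "finite F" and dg: "\<And>x. x \<in> {0..1} - F \<Longrightarrow> g differentiable (at x)"
    using g(1) unfolding valid_path_def piecewise_C1_differentiable_on_def C1_differentiable_on_eq
    by blast
  have piece: "((\<lambda>t. vector_derivative g (at t) \<star> f (g t)) has_integral
       line_int f (g (\<tau> k)) (g (\<tau> (Suc k)))) {\<tau> k..\<tau> (Suc k)}"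
    if f: "hol_on f S" and k: "k < n" for f k
  proof -
    let ?B = "ball (g (\<tau> k)) e" and ?P = "line_int f (g (\<tau> k))"
    have P: "(?P has_derivative (\<lambda>h. h \<star> f z)) (at z)" if "z \<in> ?B" for z
      by (rule has_derivative_line_int[OF _ _ _ that hol_on_subset[OF f ball[OF k]]]) (use e in auto)
    have "((\<lambda>t. vector_derivative g (at t) \<star> f (g t)) has_integral
       ?P (g (\<tau> (Suc k))) - ?P (g (\<tau> k))) {\<tau> k..\<tau> (Suc k)}"
    \<comment> \<open>This version tolerates the finite set \<open>F\<close> of break points and
      asks only for continuity of the composite with the primitive, so no bound on the derivative of
      g enters.\<close>
    proof (rule fundamental_theorem_of_calculus_interior_strong[OF F mono])
      fix t assume t: "t \<in> {\<tau> k<..<\<tau> (Suc k)} - F"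
      have "t \<in> {0..1} - F" using t \<tau>[of k] \<tau>[of "Suc k"] k by auto
      then have "(g has_derivative (\<lambda>h. h *\<^sub>R vector_derivative g (at t))) (at t)"
        using dg by (auto simp: vector_derivative_works has_vector_derivative_def)
      from has_derivative_compose[OF this P[OF inball[OF k]]]
      have "((\<lambda>t. ?P (g t)) has_derivative (\<lambda>h. (h *\<^sub>R vector_derivative g (at t)) \<star> f (g t))) (at t)"
        using t by auto
      then show "((\<lambda>t. ?P (g t)) has_vector_derivative vector_derivative g (at t) \<star> f (g t)) (at t)"
        by (simp add: has_vector_derivative_def scaleR_left)
    next
      have "continuous_on ?B ?P"
        using P by (meson continuous_at_imp_continuous_on has_derivative_continuous)
      moreover have "continuous_on {\<tau> k..\<tau> (Suc k)} g"
        by (rule continuous_on_subset[OF cg]) (use \<tau>[of k] \<tau>[of "Suc k"] k in auto)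
      ultimately show "continuous_on {\<tau> k..\<tau> (Suc k)} (\<lambda>t. ?P (g t))"
        by (rule continuous_on_compose2) (use inball[OF k] in auto)
    qed
    then show ?thesis by simp
  qed
  have part: "((\<lambda>t. vector_derivative g (at t) \<star> f (g t)) has_integral
       (\<Sum>k<m. line_int f (g (\<tau> k)) (g (\<tau> (Suc k))))) {0..\<tau> m}"
    if f: "hol_on f S" and "m \<le> n" for f m
    using that(2)
  proof (induction m)
    case 0
    then show ?case using has_integral_refl(2)[of _ "0::real"] by (simp add: \<tau>_def)
  next
    case (Suc m)
    have "0 \<le> \<tau> m" by (simp add: \<tau>_def)
    from has_integral_combine[OF this mono[of m] Suc.IH piece[OF f]] Suc.prems show ?case by simp
  qed
  show thesis
  proof (rule that)
    fix k assume k: "k < n"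
    have "g (\<tau> (Suc k)) \<in> ball (g (\<tau> k)) e" using inball[OF k] mono by auto
    then have "closed_segment (g (\<tau> k)) (g (\<tau> (Suc k))) \<subseteq> ball (g (\<tau> k)) e"
      using e by (intro closed_segment_subset) auto
    then show "closed_segment (g (\<tau> k)) (g (\<tau> (Suc k))) \<subseteq> S" using ball[OF k] by blast
  next
    fix f assume "hol_on f S"
    from part[OF this order.refl] show "((\<lambda>t. vector_derivative g (at t) \<star> f (g t)) has_integral
        (\<Sum>k<n. line_int f (g (\<tau> k)) (g (\<tau> (Suc k))))) {0..1}"
      using n by (simp add: \<tau>_def)
  qed
qed

section \<open>Path integrals and integrals of Cauchy type\<close>

definition path_int :: "(real \<Rightarrow> complex) \<Rightarrow> (complex \<Rightarrow> 'b) \<Rightarrow> 'b" where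
  "path_int g f = integral {0..1} (\<lambda>t. vector_derivative g (at t) \<star> f (g t))"

lemma path_integrable_hol:
  assumes "valid_path g" "path_image g \<subseteq> S" "open S" "hol_on f S"
  shows "(\<lambda>t. vector_derivative g (at t) \<star> f (g t)) integrable_on {0..1}"
proof (rule path_integral_polygon[OF assms(1-3)])
  fix n \<tau>
  assume "\<And>f. hol_on f S \<Longrightarrow> ((\<lambda>t. vector_derivative g (at t) \<star> f (g t)) has_integral
      (\<Sum>k<n. line_int f (g (\<tau> k)) (g (\<tau> (Suc k))))) {0..1}"
  then show ?thesis using assms(4) has_integral_integrable by blast
qed

lemma has_integral_path_int:
  assumes "valid_path g" "path_image g \<subseteq> S" "open S" "hol_on f S"
  shows "((\<lambda>t. vector_derivative g (at t) \<star> f (g t)) has_integral path_int g f) {0..1}"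
  unfolding path_int_def by (rule integrable_integral[OF path_integrable_hol[OF assms]])

text \<open>The bridge to scalar contour integrals, and through them to winding numbers.\<close>

lemma path_int_const:
  assumes "valid_path g" "path_image g \<subseteq> S" "open S" "\<phi> holomorphic_on S"
  shows "path_int g (\<lambda>w. \<phi> w \<star> v) = contour_integral g \<phi> \<star> v"
proof -
  have "\<phi> contour_integrable_on g"
    using assms by (auto intro: contour_integrable_holomorphic_simple)
  then have "((\<lambda>t. \<phi> (g t) * vector_derivative g (at t)) has_integral contour_integral g \<phi>) {0..1}"
    using has_contour_integral_integral has_contour_integral by blast
  from has_integral_linear[OF this bounded_linear_left[of v]]
  show ?thesis
    unfolding path_int_def by (intro integral_unique) (simp add: o_def cs_mult cs_commute)
qed

text \<open>The derivative of g may be discontinuous in t, which blocks differentiation under the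
  path integral itself. For z near \<open>z0\<close>, however, one inscribed polygon computes the
  integral for all z at once, and on its segments the integrands are continuous.\<close>

lemma hol_on_cauchy_integral:
  assumes g: "valid_path g" "path_image g \<subseteq> S" and S: "open S" and f: "hol_on f S"
    and V: "open V" "V \<inter> path_image g = {}"
  shows "hol_on (\<lambda>z. path_int g (\<lambda>w. (1 / (w - z)) \<star> f w)) V"
proof -
  define K where "K z = path_int g (\<lambda>w. (1 / (w - z)) \<star> f w)" for z
  define K' where "K' z = path_int g (\<lambda>w. (1 / (w - z)\<^sup>2) \<star> f w)" for z
  have loc: "\<exists>e>0. (\<forall>z\<in>ball z0 e. (K has_derivative (\<lambda>h. h \<star> K' z)) (at z)) \<and> continuous_on (ball z0 e) K'"
    if z0: "z0 \<in> V" for z0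
  proof -
    obtain e where e: "e > 0" "cball z0 e \<subseteq> V" using z0 V open_contains_cball by blast
    \<comment> \<open>Removing the whole closed ball makes the kernels 1/(w - z)^j holomorphic on
      one domain for every z in the open ball, so the polygon does not depend on z.\<close>
    let ?B = "ball z0 e" and ?S = "S - cball z0 e"
    have S': "open ?S" using S by auto
    have gS': "path_image g \<subseteq> ?S" using e V g by auto
    have fS': "hol_on f ?S" using f hol_on_subset by blast
    note cf = hol_on_imp_continuous_on[OF fS']
    obtain n \<tau> where seg: "\<And>k. k < n \<Longrightarrow> closed_segment (g (\<tau> k)) (g (\<tau> (Suc k))) \<subseteq> ?S"
      and poly: "\<And>f. hol_on f ?S \<Longrightarrow> ((\<lambda>t. vector_derivative g (at t) \<star> f (g t)) has_integral
        (\<Sum>k<n. line_int f (g (\<tau> k)) (g (\<tau> (Suc k))))) {0..1}"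
      by (rule path_integral_polygon[OF g(1) gS' S']) (rule that)
    have hol: "hol_on (\<lambda>w. (1 / (w - z) ^ j) \<star> f w) ?S" if "z \<in> ?B" for z j
      by (rule hol_on_cs[OF _ fS' S']) (use that in \<open>auto intro!: holomorphic_intros\<close>)
    have K: "K z = (\<Sum>k<n. line_int (\<lambda>w. (1 / (w - z)) \<star> f w) (g (\<tau> k)) (g (\<tau> (Suc k))))"
      if "z \<in> ?B" for z
      using poly[OF hol[OF that, of 1]] unfolding K_def path_int_def by (simp add: integral_unique)
    have K': "K' z = (\<Sum>k<n. line_int (\<lambda>w. (1 / (w - z)\<^sup>2) \<star> f w) (g (\<tau> k)) (g (\<tau> (Suc k))))"
      if "z \<in> ?B" for z
      using poly[OF hol[OF that, of 2]] unfolding K'_def path_int_def by (simp add: integral_unique)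
    have piece: "(\<forall>z\<in>?B. ((\<lambda>z. line_int (\<lambda>w. (1 / (w - z)) \<star> f w) a b) has_derivative
          (\<lambda>h. h \<star> line_int (\<lambda>w. (1 / (w - z)\<^sup>2) \<star> f w) a b)) (at z)) \<and>
        continuous_on ?B (\<lambda>z. line_int (\<lambda>w. (1 / (w - z)\<^sup>2) \<star> f w) a b)"
      if ab: "closed_segment a b \<subseteq> ?S" for a b
    proof -
      let ?w = "\<lambda>t. a + t *\<^sub>R (b - a)"
      have w: "?w t \<in> ?S" if "t \<in> {0..1}" for t
        using ab that by (force simp: closed_segment_def algebra_simps)
      then have ne: "?w t - z \<noteq> 0" if "z \<in> ?B" "t \<in> {0..1}" for z t
        using that by force
      have cw: "continuous_on {0..1} (\<lambda>t. f (?w t))"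
        by (rule continuous_on_compose2[OF cf]) (use w in \<open>auto intro!: continuous_intros\<close>)
      have cw2: "continuous_on (?B \<times> {0..1}) (\<lambda>x. f (?w (snd x)))"
        by (rule continuous_on_compose2[OF cw]) (auto intro!: continuous_intros)
      have c': "continuous_on (?B \<times> {0..1}) (\<lambda>(z, t). (1 / (?w t - z)\<^sup>2) \<star> f (?w t))"
        unfolding split_beta
        by (intro continuous_on cw2 continuous_intros) (use ne in force)
      have c: "continuous_on {0..1} (\<lambda>t. (1 / (?w t - z)) \<star> f (?w t))" if "z \<in> ?B" for z
        by (intro continuous_on cw continuous_intros) (use ne that in force)
      have d: "((\<lambda>z. (1 / (?w t - z)) \<star> f (?w t)) has_derivative
          (\<lambda>h. h \<star> (1 / (?w t - z)\<^sup>2) \<star> f (?w t))) (at z)" if "z \<in> ?B" "t \<in> {0..1}" for z t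
      proof -
        have "((\<lambda>z. 1 / (?w t - z)) has_field_derivative 1 / (?w t - z)\<^sup>2) (at z)"
          using ne[OF that] by (auto intro!: derivative_eq_intros simp: power2_eq_square)
        then have "((\<lambda>z. 1 / (?w t - z)) has_derivative (\<lambda>h. h * (1 / (?w t - z)\<^sup>2))) (at z)"
          unfolding has_field_derivative_def by (rule has_derivative_eq_rhs) (simp add: fun_eq_iff)
        from bounded_linear.has_derivative[OF bounded_linear_left this, of "f (?w t)"]
        show ?thesis by (simp only: cs_mult)
      qed
      have D: "((\<lambda>z. integral {0..1} (\<lambda>t. (1 / (?w t - z)) \<star> f (?w t))) has_derivative
         (\<lambda>h. h \<star> integral {0..1} (\<lambda>t. (1 / (?w t - z)\<^sup>2) \<star> f (?w t)))) (at z)" if "z \<in> ?B" for z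
        by (rule has_derivative_integral_param[OF open_ball that d c c'])
      have "continuous_on ?B (\<lambda>z. integral {0..1} (\<lambda>t. (1 / (?w t - z)\<^sup>2) \<star> f (?w t)))"
        using integral_continuous_on_param[of ?B 0 1 "\<lambda>z t. (1 / (?w t - z)\<^sup>2) \<star> f (?w t)"] c' by simp
      then show ?thesis
        unfolding line_int_def
        using bounded_linear.has_derivative[OF bounded_linear_right D, of _ "b - a"]
        by (auto intro!: continuous_on continuous_on_const simp: cs_commute[of "b - a"])
    qed
    have "(K has_derivative (\<lambda>h. h \<star> K' z)) (at z)" if "z \<in> ?B" for z
    proof (rule has_derivative_transform_within_open[OF _ open_ball that])
      show "((\<lambda>z. \<Sum>k<n. line_int (\<lambda>w. (1 / (w - z)) \<star> f w) (g (\<tau> k)) (g (\<tau> (Suc k)))) has_derivative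
        (\<lambda>h. h \<star> K' z)) (at z)"
        unfolding K'[OF that] sum_right
        by (intro has_derivative_sum) (use piece[OF seg] that in auto)
    qed (simp add: K)
    moreover have "continuous_on ?B (\<lambda>z. \<Sum>k<n. line_int (\<lambda>w. (1 / (w - z)\<^sup>2) \<star> f w) (g (\<tau> k)) (g (\<tau> (Suc k))))"
      by (intro continuous_on_sum) (use piece[OF seg] in auto)
    then have "continuous_on ?B K'" by (rule continuous_on_eq) (simp add: K')
    ultimately show ?thesis using e(1) by blast
  qed
  then have "(K has_derivative (\<lambda>h. h \<star> K' z)) (at z)" if "z \<in> V" for z
    using that centre_in_ball by blast
  moreover have "continuous_on V K'"
  proof (rule continuous_at_imp_continuous_on, rule ballI)
    fix z assume "z \<in> V"
    then obtain e where "e > 0" "continuous_on (ball z e) K'" using loc by blast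
    then show "isCont K' z" by (simp add: continuous_on_eq_continuous_at)
  qed
  ultimately show ?thesis unfolding K_def by (intro hol_onI)
qed

text \<open>Let \<phi>(r) be the mean of f over the circle of radius r about z. Its r-derivative is
  the mean of e(t) f'(z + r e(t)), a multiple of the integral of a t-derivative over a closed loop,
  hence 0. So the mean is constant for r > 0; large r shows that it is 0, and r \<rightarrow> 0
  identifies it with f(z).\<close>

lemma liouville:
  assumes f: "hol_on f UNIV" and lim: "(f \<longlongrightarrow> 0) at_infinity"
  shows "f z = 0"
proof -
  obtain f' where cf': "continuous_on UNIV f'"
    and der: "\<And>z. (f has_derivative (\<lambda>h. h \<star> f' z)) (at z)"
    using f unfolding hol_on_def by blast
  note cf = hol_on_imp_continuous_on[OF f]
  define e where "e t = exp (2 * of_real pi * \<i> * of_real t)" for t :: real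
  have ce: "continuous_on A e" for A unfolding e_def by (intro continuous_intros)
  have de: "(e has_vector_derivative 2 * of_real pi * \<i> * e t) (at t within A)" for t A
    unfolding e_def
    by (rule has_vector_derivative_real_field) (auto intro!: derivative_eq_intros)
  define \<phi> where "\<phi> r = integral {0..1} (\<lambda>t. f (z + r *\<^sub>R e t))" for r
  have c1: "continuous_on {0..1} (\<lambda>t. f (z + r *\<^sub>R e t))" for r
    by (intro continuous_on_compose2[OF cf] continuous_intros ce) auto
  have c2: "continuous_on {0..1} (\<lambda>t. e t \<star> f' (z + r *\<^sub>R e t))" for r
    by (intro continuous_on continuous_on_compose2[OF cf'] continuous_intros ce) auto
  have c0: "continuous_on UNIV \<phi>"
  proof -
    have "continuous_on (UNIV \<times> cbox 0 1) (\<lambda>(r, t). f (z + r *\<^sub>R e t))"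
      unfolding split_beta
      by (intro continuous_on_compose2[OF cf] continuous_intros continuous_on_compose2[OF ce[of UNIV]]) auto
    from integral_continuous_on_param[OF this] show ?thesis by (simp add: \<phi>_def[abs_def])
  qed
  have int0: "integral {0..1} (\<lambda>t. e t \<star> f' (z + r *\<^sub>R e t)) = 0" if r: "r > 0" for r
  proof -
    \<comment> \<open>The chain-rule factor: the t-derivative of r e(t) is
      \<open>?c * e t\<close>.\<close>
    let ?c = "r *\<^sub>R (2 * of_real pi * \<i>)"
    have "((\<lambda>t. f (z + r *\<^sub>R e t)) has_vector_derivative ?c \<star> e t \<star> f' (z + r *\<^sub>R e t)) (at t within {0..1})" for t
    proof -
      have "((\<lambda>t. z + r *\<^sub>R e t) has_derivative (\<lambda>h. h *\<^sub>R (?c * e t))) (at t within {0..1})"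
        using de[of t "{0..1}"] unfolding has_vector_derivative_def
        by (auto intro!: derivative_eq_intros)
      from has_derivative_compose[OF this der]
      show ?thesis by (simp add: has_vector_derivative_def scaleR_left cs_mult)
    qed
    then have "((\<lambda>t. ?c \<star> e t \<star> f' (z + r *\<^sub>R e t)) has_integral f (z + r *\<^sub>R e 1) - f (z + r *\<^sub>R e 0)) {0..1}"
      by (intro fundamental_theorem_of_calculus) auto
    moreover have "e 1 = e 0" by (simp add: e_def)
    moreover have "((\<lambda>t. ?c \<star> e t \<star> f' (z + r *\<^sub>R e t)) has_integral
        ?c \<star> integral {0..1} (\<lambda>t. e t \<star> f' (z + r *\<^sub>R e t))) {0..1}"
      by (intro has_integral_linear[OF integrable_integral bounded_linear_right, unfolded o_def]
          integrable_continuous_interval c2)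
    ultimately have "?c \<star> integral {0..1} (\<lambda>t. e t \<star> f' (z + r *\<^sub>R e t)) = 0"
      by (auto dest: has_integral_unique)
    then show ?thesis using r by (subst (asm) cs_cancel) auto
  qed
  have "(\<phi> has_vector_derivative integral (cbox 0 1) (\<lambda>t. e t \<star> f' (z + r *\<^sub>R e t))) (at r within {0<..})"
    if r: "r > 0" for r
  proof -
    have "((\<lambda>r. integral (cbox 0 1) (\<lambda>t. f (z + r *\<^sub>R e t))) has_vector_derivative
       integral (cbox 0 1) (\<lambda>t. e t \<star> f' (z + r *\<^sub>R e t))) (at r within {0<..})"
    proof (rule leibniz_rule_vector_derivative)
      fix r t
      have "((\<lambda>r. z + r *\<^sub>R e t) has_derivative (\<lambda>h. h *\<^sub>R e t)) (at r within {0<..})"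
        by (auto intro!: derivative_eq_intros)
      from has_derivative_compose[OF this der]
      show "((\<lambda>r. f (z + r *\<^sub>R e t)) has_vector_derivative e t \<star> f' (z + r *\<^sub>R e t)) (at r within {0<..})"
        by (simp add: has_vector_derivative_def scaleR_left)
    next
      show "continuous_on ({0<..} \<times> cbox 0 1) (\<lambda>(r, t). e t \<star> f' (z + r *\<^sub>R e t))"
        unfolding split_beta
        by (intro continuous_on continuous_on_compose2[OF cf'] continuous_intros
            continuous_on_compose2[OF ce[of UNIV]]) auto
    qed (use r c1 in \<open>auto intro: integrable_continuous_interval\<close>)
    then show ?thesis by (simp add: \<phi>_def[abs_def])
  qed
  then have "(\<phi> has_vector_derivative 0) (at r within {0<..})" if "r > 0" for r
    using int0[OF that] that by fastforce
  then obtain C where C: "\<And>r. r > 0 \<Longrightarrow> \<phi> r = C"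
    using has_vector_derivative_zero_constant[of "{0<..}" \<phi>] by auto
  have "norm C \<le> \<epsilon>" if \<epsilon>: "\<epsilon> > 0" for \<epsilon>
  proof -
    obtain b where b: "\<And>w. norm w \<ge> b \<Longrightarrow> norm (f w) < \<epsilon>"
      using tendstoD[OF lim \<epsilon>] by (auto simp: eventually_at_infinity)
    \<comment> \<open>So large that the circle about z stays outside the disc of radius b, since its
      points have norm at least r - |z|.\<close>
    define r where "r = \<bar>b\<bar> + norm z + 1"
    have "norm (f (z + r *\<^sub>R e t)) \<le> \<epsilon>" for t
    proof -
      have "norm (e t) = 1" by (simp add: e_def norm_exp_eq_Re)
      then have "norm (r *\<^sub>R e t) = r" by (simp add: r_def)
      then have "r \<le> norm (z + r *\<^sub>R e t) + norm z"
        using norm_triangle_ineq4[of "z + r *\<^sub>R e t" z] by simp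
      moreover have "b \<le> r - norm z" by (simp add: r_def)
      ultimately have "b \<le> norm (z + r *\<^sub>R e t)" by linarith
      then show ?thesis using b by (simp add: less_imp_le)
    qed
    then have "norm (\<phi> r) \<le> \<epsilon> * (1 - 0)"
      unfolding \<phi>_def by (intro integral_bound c1) auto
    moreover have "r > 0" unfolding r_def by (simp add: add_nonneg_pos)
    ultimately show ?thesis using C[of r] by simp
  qed
  then have "C = 0" using field_le_epsilon[of "norm C" 0] by simp
  \<comment> \<open>The derivative was computed for r > 0 only; continuity carries the constant to r
    = 0, where the integrand is constantly f(z).\<close>
  have "(\<phi> \<longlongrightarrow> \<phi> 0) (at_right 0)"
  proof (rule tendsto_within_subset)
    show "(\<phi> \<longlongrightarrow> \<phi> 0) (at 0)"
      using c0 by (simp add: continuous_on_eq_continuous_at isCont_def)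
  qed simp
  moreover have "(\<phi> \<longlongrightarrow> 0) (at_right 0)"
    by (rule tendsto_eventually[OF eventually_mono[OF eventually_at_right_less]])
      (simp add: C \<open>C = 0\<close>)
  ultimately have "\<phi> 0 = 0" by (rule tendsto_unique[OF trivial_limit_at_right_real])
  then show ?thesis by (simp add: \<phi>_def)
qed

section \<open>Gluing and recognising holomorphic functions\<close>

lemma hol_on_deriv:
  assumes "hol_on f S"
  shows "continuous_on S (\<lambda>z. frechet_derivative f (at z) 1)"
    and "\<And>z. z \<in> S \<Longrightarrow> (f has_derivative (\<lambda>h. h \<star> frechet_derivative f (at z) 1)) (at z)"
proof -
  obtain f' where f': "continuous_on S f'" "\<And>z. z \<in> S \<Longrightarrow> (f has_derivative (\<lambda>h. h \<star> f' z)) (at z)"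
    using assms unfolding hol_on_def by blast
  have eq: "frechet_derivative f (at z) 1 = f' z" if "z \<in> S" for z
    using frechet_derivative_at[OF f'(2)[OF that], symmetric] by (simp add: cs_one)
  show "continuous_on S (\<lambda>z. frechet_derivative f (at z) 1)"
    by (rule continuous_on_eq[OF f'(1)]) (simp add: eq)
  show "(f has_derivative (\<lambda>h. h \<star> frechet_derivative f (at z) 1)) (at z)" if "z \<in> S" for z
    using f'(2)[OF that] by (simp add: eq[OF that])
qed

text \<open>The two hypotheses supply unrelated derivative functions. Replacing both by the
  canonical \<open>frechet_derivative f (at z) 1\<close> makes them agree on the overlap, so
  continuity glues over the two open sets.\<close>

lemma hol_on_Un:
  assumes "hol_on f S" "hol_on f T" "open S" "open T"
  shows "hol_on f (S \<union> T)"
  using hol_on_deriv[OF assms(1)] hol_on_deriv[OF assms(2)]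
  by (intro hol_onI[where f' = "\<lambda>z. frechet_derivative f (at z) 1"] continuous_on_open_Un assms(3,4)) auto

lemma hol_on_cong:
  assumes "hol_on f S" "open S" "\<And>z. z \<in> S \<Longrightarrow> f z = g z"
  shows "hol_on g S"
proof -
  obtain f' where f': "continuous_on S f'" "\<And>z. z \<in> S \<Longrightarrow> (f has_derivative (\<lambda>h. h \<star> f' z)) (at z)"
    using assms unfolding hol_on_def by blast
  show ?thesis
    by (rule hol_onI[OF f'(1)], rule has_derivative_transform_within_open[OF f'(2) assms(2)])
      (use assms(3) in auto)
qed

lemma hol_on_linear:
  assumes f: "hol_on f S" and A: "bounded_linear A" "\<And>c x. A (c \<star> x) = c \<star> A x"
  shows "hol_on (\<lambda>z. A (f z)) S"
proof -
  obtain f' where f': "continuous_on S f'" "\<And>z. z \<in> S \<Longrightarrow> (f has_derivative (\<lambda>h. h \<star> f' z)) (at z)"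
    using f unfolding hol_on_def by blast
  show ?thesis
    using bounded_linear.has_derivative[OF A(1) f'(2)]
    by (intro hol_onI[OF bounded_linear.continuous_on[OF A(1) f'(1)]]) (simp add: A(2))
qed

text \<open>Caratheodory's criterion, suited to functions whose increments factor algebraically: the
  derivative is the value of the quotient \<open>k\<close> on the diagonal. It is made for
  \<open>R_diff\<close>.\<close>

lemma hol_on_caratheodory:
  assumes S: "open S" and eq: "\<And>z w. z \<in> S \<Longrightarrow> w \<in> S \<Longrightarrow> f w - f z = (w - z) \<star> k z w"
    and k: "\<And>z. z \<in> S \<Longrightarrow> isCont (k z) z" and k': "continuous_on S (\<lambda>z. k z z)"
  shows "hol_on f S"
proof (rule hol_onI[OF k'])
  fix z assume z: "z \<in> S"
  obtain K where K: "\<And>a b. norm (a \<star> b) \<le> norm a * norm b * K" using bounded by blast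
  have lim: "((\<lambda>w. norm (k z w - k z z) * K) \<longlongrightarrow> 0 * K) (at z)"
    using k[OF z] by (intro tendsto_intros) (simp add: isCont_def tendsto_norm_zero LIM_zero)
  have "\<forall>\<^sub>F w in at z. w \<in> S" using S z by (rule eventually_at_in_open')
  then have bnd: "\<forall>\<^sub>F w in at z. norm ((f w - f z - (w - z) \<star> k z z) /\<^sub>R norm (w - z)) \<le> norm (k z w - k z z) * K"
  proof eventually_elim
    case (elim w)
    show ?case
    proof (cases "w = z")
      case False
      have "f w - f z - (w - z) \<star> k z z = (w - z) \<star> (k z w - k z z)"
        using eq[OF z elim] by (simp add: diff_right)
      then show ?thesis using K[of "w - z" "k z w - k z z"] False by (simp add: field_simps)
    qed (simp add: zero_left)
  qed
  have "((\<lambda>w. (f w - f z - (w - z) \<star> k z z) /\<^sub>R norm (w - z)) \<longlongrightarrow> 0) (at z)"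
    by (rule Lim_null_comparison[OF bnd lim[unfolded mult_zero_left]])
  then show "(f has_derivative (\<lambda>h. h \<star> k z z)) (at z)"
    by (simp add: has_derivative_within bounded_linear_left inverse_eq_divide diff_diff_eq)
qed

section \<open>Integrals over finite families of closed paths\<close>

definition cycle_int :: "(real \<Rightarrow> complex) list \<Rightarrow> (complex \<Rightarrow> 'b) \<Rightarrow> 'b" where
  "cycle_int gs f = (\<Sum>g\<leftarrow>gs. path_int g f)"

text \<open>Openness of S accompanies the paths because integrability rests on local primitives.
  That the paths are closed makes the integrals of w^k vanish in
  \<open>cycle_int_pow\<close>.\<close>

definition cycle_in :: "(real \<Rightarrow> complex) list \<Rightarrow> complex set \<Rightarrow> bool" where
  "cycle_in gs S \<longleftrightarrow> open S \<and>
     (\<forall>g\<in>set gs. valid_path g \<and> pathfinish g = pathstart g \<and> path_image g \<subseteq> S)"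

lemma cycle_int_add:
  assumes "cycle_in gs S" "hol_on f S" "hol_on f2 S"
  shows "cycle_int gs (\<lambda>w. f w + f2 w) = cycle_int gs f + cycle_int gs f2"
proof -
  have "path_int g (\<lambda>w. f w + f2 w) = path_int g f + path_int g f2" if "g \<in> set gs" for g
    using has_integral_add[OF has_integral_path_int[of g S f] has_integral_path_int[of g S f2]]
      assms that
    unfolding path_int_def[of g "\<lambda>w. f w + f2 w"] cycle_in_def
    by (intro integral_unique) (simp add: add_right)
  then show ?thesis
    unfolding cycle_int_def sum_list_addf[symmetric] by (simp cong: map_cong)
qed

lemma cycle_int_linear:
  assumes "cycle_in gs S" "hol_on f S" and A: "bounded_linear A" "\<And>c x. A (c \<star> x) = c \<star> A x"
  shows "cycle_int gs (\<lambda>w. A (f w)) = A (cycle_int gs f)"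
proof -
  interpret A: bounded_linear A by fact
  have "path_int g (\<lambda>w. A (f w)) = A (path_int g f)" if "g \<in> set gs" for g
    using has_integral_linear[OF has_integral_path_int[of g S f] A(1)] assms(1,2) that
    unfolding path_int_def[of g "\<lambda>w. A (f w)"] cycle_in_def
    by (intro integral_unique) (simp add: A(2) o_def)
  then have "cycle_int gs (\<lambda>w. A (f w)) = (\<Sum>g\<leftarrow>gs. A (path_int g f))"
    unfolding cycle_int_def by (simp cong: map_cong)
  also have "\<dots> = A (cycle_int gs f)"
    unfolding cycle_int_def by (induction gs) (simp_all add: A.zero A.add)
  finally show ?thesis .
qed

lemma cycle_int_const:
  assumes "cycle_in gs S" "\<phi> holomorphic_on S"
  shows "cycle_int gs (\<lambda>w. \<phi> w \<star> v) = (\<Sum>g\<leftarrow>gs. contour_integral g \<phi>) \<star> v"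
proof -
  have "path_int g (\<lambda>w. \<phi> w \<star> v) = contour_integral g \<phi> \<star> v" if "g \<in> set gs" for g
    using assms that unfolding cycle_in_def by (intro path_int_const[of g S]) auto
  then have "cycle_int gs (\<lambda>w. \<phi> w \<star> v) = (\<Sum>g\<leftarrow>gs. contour_integral g \<phi> \<star> v)"
    unfolding cycle_int_def by (simp cong: map_cong)
  also have "\<dots> = (\<Sum>g\<leftarrow>gs. contour_integral g \<phi>) \<star> v"
    by (induction gs) (simp_all add: zero_left add_left)
  finally show ?thesis .
qed

lemma cycle_int_cong:
  assumes "cycle_in gs S" "\<And>w. w \<in> S \<Longrightarrow> f w = f2 w"
  shows "cycle_int gs f = cycle_int gs f2"
proof -
  have "path_int g f = path_int g f2" if "g \<in> set gs" for g
    unfolding path_int_def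
  proof (rule integral_cong)
    fix t :: real assume "t \<in> {0..1}"
    then have "g t \<in> S" using assms(1) that unfolding cycle_in_def path_image_def by blast
    then show "vector_derivative g (at t) \<star> f (g t) = vector_derivative g (at t) \<star> f2 (g t)"
      using assms(2) by simp
  qed
  then show ?thesis unfolding cycle_int_def by (simp cong: map_cong)
qed

end

section \<open>Invertible operators and the resolvent of a quadratic pencil\<close>

lemma blinfun_compose_assoc: "(A o\<^sub>L B) o\<^sub>L C = A o\<^sub>L (B o\<^sub>L C)"
  by (rule blinfun_eqI) simp

lemma blinfun_compose_id [simp]: "id_blinfun o\<^sub>L A = A" "A o\<^sub>L id_blinfun = A"
  by (auto intro: blinfun_eqI)

interpretation comp: bounded_bilinear blinfun_compose
  by (rule bounded_bilinear_blinfun_compose)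

lemmas comp_simps = comp.add_left comp.add_right comp.diff_left comp.diff_right
  comp.minus_left comp.minus_right blinfun_compose_assoc

definition inverse_pair :: "('a::real_normed_vector \<Rightarrow>\<^sub>L 'a) \<Rightarrow> ('a \<Rightarrow>\<^sub>L 'a) \<Rightarrow> bool" where
  "inverse_pair B A \<longleftrightarrow> B o\<^sub>L A = id_blinfun \<and> A o\<^sub>L B = id_blinfun"

lemma inverse_pair_unique:
  assumes "inverse_pair B A" "inverse_pair C A"
  shows "B = C"
  using assms unfolding inverse_pair_def by (metis blinfun_compose_assoc blinfun_compose_id)

lemma inverse_pair_commute:
  assumes "inverse_pair B A" "A o\<^sub>L C = C o\<^sub>L A"
  shows "B o\<^sub>L C = C o\<^sub>L B"
  using assms unfolding inverse_pair_def by (metis blinfun_compose_assoc blinfun_compose_id)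

lemma bpow_0 [simp]: "bpow A 0 = id_blinfun"
  by (simp add: bpow_def)

lemma bpow_Suc: "bpow A (Suc n) = A o\<^sub>L bpow A n"
  by (simp add: bpow_def)

lemma bpow_commute:
  assumes "A o\<^sub>L B = B o\<^sub>L A"
  shows "bpow A n o\<^sub>L B = B o\<^sub>L bpow A n"
  by (induction n) (simp_all add: bpow_Suc, metis assms blinfun_compose_assoc)

lemma norm_bpow: "norm (bpow A n) \<le> norm A ^ n"
proof (induction n)
  case (Suc n)
  have "norm (bpow A (Suc n)) \<le> norm A * norm (bpow A n)"
    unfolding bpow_Suc by (rule norm_blinfun_compose)
  also have "\<dots> \<le> norm A * norm A ^ n" by (intro mult_left_mono Suc) auto
  finally show ?case by simp
\<comment> \<open>Only an inequality holds for n = 0: on the zero space the identity has norm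
  0.\<close>
qed (simp add: norm_blinfun_id_le)

lemma neumann_series:
  fixes A :: "'a::banach \<Rightarrow>\<^sub>L 'a"
  assumes "norm A < 1"
  obtains B where "inverse_pair B (id_blinfun - A)"
proof -
  have s: "summable (bpow A)"
    by (rule summable_comparison_test'[where g = "\<lambda>n. norm A ^ n" and N = 0])
      (use assms norm_bpow in \<open>auto intro: summable_geometric\<close>)
  define B where "B = suminf (bpow A)"
  \<comment> \<open>Splitting off the term n = 0 identifies both A B and B A with B minus the
    identity.\<close>
  have B: "B = id_blinfun + (\<Sum>n. bpow A (Suc n))"
    using suminf_split_head[OF s] by (simp add: B_def)
  have "A o\<^sub>L B = (\<Sum>n. A o\<^sub>L bpow A n)"
    unfolding B_def by (rule bounded_linear.suminf[OF comp.bounded_linear_right s])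
  moreover have "B o\<^sub>L A = (\<Sum>n. bpow A n o\<^sub>L A)"
    unfolding B_def by (rule bounded_linear.suminf[OF comp.bounded_linear_left s])
  ultimately have "A o\<^sub>L B = B - id_blinfun" "B o\<^sub>L A = B - id_blinfun"
    using B by (simp_all add: bpow_Suc bpow_commute)
  then have "inverse_pair B (id_blinfun - A)"
    unfolding inverse_pair_def by (simp add: comp_simps)
  then show thesis by (rule that)
qed

text \<open>B A' = 1 - B (A - A') is invertible by the Neumann series, with inverse C say. Then C B
  is a left inverse of A', and multiplying B A' C = 1 by A gives A' C = A, which makes it a right
  inverse too.\<close>

lemma inverse_pair_perturb:
  fixes A :: "'a::banach \<Rightarrow>\<^sub>L 'a"
  assumes B: "inverse_pair B A" and n: "norm B * norm (A' - A) < 1"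
  shows "\<exists>C. inverse_pair C A'"
proof -
  have "norm (B o\<^sub>L (A - A')) \<le> norm B * norm (A - A')" by (rule norm_blinfun_compose)
  then have "norm (B o\<^sub>L (A - A')) < 1" using n by (simp add: norm_minus_commute)
  then obtain C where C: "inverse_pair C (id_blinfun - (B o\<^sub>L (A - A')))"
    using neumann_series by blast
  have BA: "B o\<^sub>L A = id_blinfun" "A o\<^sub>L B = id_blinfun"
    using B unfolding inverse_pair_def by auto
  have "id_blinfun - (B o\<^sub>L (A - A')) = B o\<^sub>L A'" by (simp add: comp_simps BA)
  with C have C': "C o\<^sub>L (B o\<^sub>L A') = id_blinfun" "B o\<^sub>L (A' o\<^sub>L C) = id_blinfun"
    unfolding inverse_pair_def by (simp_all add: blinfun_compose_assoc)
  have "A' o\<^sub>L C = A"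
    using arg_cong[OF C'(2), of "\<lambda>X. A o\<^sub>L X"] by (simp add: blinfun_compose_assoc[symmetric] BA)
  then have "inverse_pair (C o\<^sub>L B) A'"
    unfolding inverse_pair_def using C' BA by (simp add: blinfun_compose_assoc[symmetric])
  then show ?thesis by blast
qed

section \<open>Quadratic pencils and their resolvent\<close>

locale quadratic_pencil =
  fixes L :: "complex \<Rightarrow> ('a::banach \<Rightarrow>\<^sub>L 'a)" and S N :: "'a \<Rightarrow>\<^sub>L 'a"
  assumes bounded_linear_L: "bounded_linear L" and L_one: "L 1 = id_blinfun"
    and L_mult: "L (a * b) = L a o\<^sub>L L b"
    and SL: "S o\<^sub>L L a = L a o\<^sub>L S" and NL: "N o\<^sub>L L a = L a o\<^sub>L N"
begin

sublocale L: bounded_linear L by (rule bounded_linear_L)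

text \<open>The complex Banach space in which the Cauchy theory runs is the space of operators, with
  scalars composed on the left. Scalars pass through \<open>S\<close>, \<open>N\<close> and
  \<open>R z\<close>, whereas products of these three are kept in order throughout.\<close>

sublocale complex_scaling "\<lambda>z A. L z o\<^sub>L A"
proof (intro complex_scaling.intro complex_scaling_axioms.intro)
  show "bounded_bilinear (\<lambda>z A. L z o\<^sub>L A)"
    by (rule comp.comp1[OF bounded_linear_L])
qed (simp_all add: L_one L_mult blinfun_compose_assoc)

lemma L_commute: "L a o\<^sub>L L b = L b o\<^sub>L L a"
  by (metis L_mult mult.commute)

lemma L_commute_left: "L a o\<^sub>L (L b o\<^sub>L X) = L b o\<^sub>L (L a o\<^sub>L X)"
  by (metis L_commute blinfun_compose_assoc)

lemma SL_left: "S o\<^sub>L (L a o\<^sub>L X) = L a o\<^sub>L (S o\<^sub>L X)"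
  by (metis SL blinfun_compose_assoc)

lemma NL_left: "N o\<^sub>L (L a o\<^sub>L X) = L a o\<^sub>L (N o\<^sub>L X)"
  by (metis NL blinfun_compose_assoc)

definition Q :: "complex \<Rightarrow> ('a \<Rightarrow>\<^sub>L 'a)" where
  "Q z = (L z o\<^sub>L L z) - (L z o\<^sub>L S) + N"

lemma Q_commute: "Q z o\<^sub>L L a = L a o\<^sub>L Q z"
  by (simp add: Q_def comp_simps SL SL_left NL NL_left L_commute L_commute_left)

lemma Q_diff: "Q w - Q z = L (w - z) o\<^sub>L (L (w + z) - S)"
  by (simp add: Q_def L.diff L.add comp_simps L_commute algebra_simps)

definition \<Omega> :: "complex set" where "\<Omega> = {z. \<exists>B. inverse_pair B (Q z)}"

text \<open>The same description by \<open>THE\<close> as in \<open>Qinv\<close>, so that on a slice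
  the two agree by unfolding.\<close>

definition R :: "complex \<Rightarrow> ('a \<Rightarrow>\<^sub>L 'a)" where "R z = (THE B. inverse_pair B (Q z))"

lemma R_eq: "inverse_pair B (Q z) \<Longrightarrow> R z = B"
  unfolding R_def by (rule the_equality) (auto intro: inverse_pair_unique)

lemma R_pair: "z \<in> \<Omega> \<Longrightarrow> inverse_pair (R z) (Q z)"
  unfolding \<Omega>_def using R_eq by auto

lemma RQ: "z \<in> \<Omega> \<Longrightarrow> R z o\<^sub>L Q z = id_blinfun" "z \<in> \<Omega> \<Longrightarrow> Q z o\<^sub>L R z = id_blinfun"
  using R_pair unfolding inverse_pair_def by auto

lemma R_commute: "z \<in> \<Omega> \<Longrightarrow> R z o\<^sub>L L a = L a o\<^sub>L R z"
  by (rule inverse_pair_commute[OF R_pair Q_commute])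

lemma R_commute_left:
  assumes "z \<in> \<Omega>"
  shows "R z o\<^sub>L (L a o\<^sub>L X) = L a o\<^sub>L (R z o\<^sub>L X)"
  by (metis R_commute[OF assms] blinfun_compose_assoc)

lemma R_diff':
  assumes "z \<in> \<Omega>" "w \<in> \<Omega>"
  shows "R w - R z = R w o\<^sub>L ((Q z - Q w) o\<^sub>L R z)"
proof -
  have "R w o\<^sub>L ((Q z - Q w) o\<^sub>L R z) = (R w o\<^sub>L (Q z o\<^sub>L R z)) - ((R w o\<^sub>L Q w) o\<^sub>L R z)"
    by (simp add: comp_simps)
  then show ?thesis using assms by (simp add: RQ)
qed

text \<open>\<open>R_diff'\<close> is used with its arguments exchanged so that \<open>R z\<close>
  ends up leftmost: in an integral over w it is then a constant left factor, which
  \<open>cycle_int_linear\<close> can pull out.\<close>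

lemma R_diff:
  assumes "z \<in> \<Omega>" "w \<in> \<Omega>"
  shows "R w - R z = L (w - z) o\<^sub>L - (R z o\<^sub>L ((L (w + z) - S) o\<^sub>L R w))"
proof -
  have "R w - R z = - (R z - R w)" by simp
  also have "R z - R w = R z o\<^sub>L ((Q w - Q z) o\<^sub>L R w)" by (rule R_diff'[OF assms(2,1)])
  also have "\<dots> = (R z o\<^sub>L L (w - z)) o\<^sub>L ((L (w + z) - S) o\<^sub>L R w)"
    by (simp only: Q_diff blinfun_compose_assoc)
  also have "\<dots> = L (w - z) o\<^sub>L (R z o\<^sub>L ((L (w + z) - S) o\<^sub>L R w))"
    by (simp only: R_commute[OF assms(1)] blinfun_compose_assoc)
  finally show ?thesis by (simp add: comp_simps)
qed

lemma continuous_on_L [continuous_intros]: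
  "continuous_on A f \<Longrightarrow> continuous_on A (\<lambda>x. L (f x))"
  by (rule L.continuous_on)

lemma continuous_on_Q: "continuous_on A Q"
  unfolding Q_def by (intro continuous_intros comp.continuous_on)

lemma isCont_Q: "isCont Q z"
  using continuous_on_Q[of UNIV] by (simp add: continuous_on_eq_continuous_at)

lemma open_\<Omega>: "open \<Omega>"
proof (rule openI)
  fix z assume z: "z \<in> \<Omega>"
  have "((\<lambda>w. norm (R z) * norm (Q w - Q z)) \<longlongrightarrow> norm (R z) * 0) (at z)"
    using isCont_Q[of z] by (intro tendsto_intros) (simp add: isCont_def tendsto_norm_zero LIM_zero)
  then have "\<forall>\<^sub>F w in at z. norm (R z) * norm (Q w - Q z) < 1"
    by (rule order_tendstoD) simp
  then have "\<forall>\<^sub>F w in at z. w \<in> \<Omega>"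
    by eventually_elim (use inverse_pair_perturb[OF R_pair[OF z]] in \<open>auto simp: \<Omega>_def\<close>)
  then obtain d where d: "d > 0" "\<And>w. w \<noteq> z \<Longrightarrow> dist w z < d \<Longrightarrow> w \<in> \<Omega>"
    by (auto simp: eventually_at)
  have "w \<in> \<Omega>" if "dist w z < d" for w using d(2)[OF _ that] z by (cases "w = z") auto
  then show "\<exists>e>0. ball z e \<subseteq> \<Omega>" using d(1) by (intro exI[of _ d]) (auto simp: dist_commute)
qed

lemma isCont_R:
  assumes z: "z \<in> \<Omega>"
  shows "isCont R z"
proof -
  define r where "r = norm (R z)"
  have lim: "((\<lambda>w. norm (Q w - Q z)) \<longlongrightarrow> 0) (at z)"
    using isCont_Q[of z] by (simp add: isCont_def tendsto_norm_zero LIM_zero)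
  have lim2: "((\<lambda>w. 2 * r\<^sup>2 * norm (Q w - Q z)) \<longlongrightarrow> 0) (at z)"
    using tendsto_mult_left[OF lim, of "2 * r\<^sup>2"] by simp
  have "((\<lambda>w. r * norm (Q w - Q z)) \<longlongrightarrow> 0) (at z)"
    using tendsto_mult_left[OF lim, of r] by simp
  \<comment> \<open>The bound 1/2 lets the term in R w be absorbed: |R w| is at most r + |R w| / 2,
    hence at most 2 r.\<close>
  then have "\<forall>\<^sub>F w in at z. r * norm (Q w - Q z) < 1/2" by (rule order_tendstoD) simp
  moreover have "\<forall>\<^sub>F w in at z. w \<in> \<Omega>" using open_\<Omega> z by (rule eventually_at_in_open')
  ultimately have "\<forall>\<^sub>F w in at z. norm (R w - R z) \<le> 2 * r\<^sup>2 * norm (Q w - Q z)"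
  proof eventually_elim
    case (elim w)
    let ?q = "norm (Q w - Q z)"
    have "norm (R w - R z) \<le> norm (R w) * (norm (Q z - Q w) * norm (R z))"
      unfolding R_diff'[OF z elim(2)]
      by (rule order_trans[OF norm_blinfun_compose mult_left_mono[OF norm_blinfun_compose]]) simp
    then have d: "norm (R w - R z) \<le> norm (R w) * (r * ?q)"
      by (simp add: r_def norm_minus_commute mult.commute)
    also have "\<dots> \<le> norm (R w) * (1/2)" using elim by (intro mult_left_mono) auto
    finally have "norm (R w) \<le> 2 * r"
      using norm_triangle_ineq2[of "R w" "R z"] by (simp add: r_def)
    then have "norm (R w) * (r * ?q) \<le> 2 * r * (r * ?q)"
      by (intro mult_right_mono) (auto simp: r_def)
    then show ?case using d by (simp add: power2_eq_square mult.assoc)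
  qed
  then have "((\<lambda>w. R w - R z) \<longlongrightarrow> 0) (at z)" using lim2 by (rule Lim_null_comparison)
  then show ?thesis by (simp add: isCont_def LIM_zero_iff)
qed

lemma continuous_on_R: "continuous_on \<Omega> R"
  by (intro continuous_at_imp_continuous_on ballI isCont_R)

text \<open>The factor in \<open>R_diff\<close> is an exact difference quotient; at w = z it becomes
  - R (2 z - S) R, which is - R Q' R.\<close>

lemma hol_on_R: "hol_on R \<Omega>"
proof (rule hol_on_caratheodory[OF open_\<Omega>, where k = "\<lambda>z w. - (R z o\<^sub>L ((L (w + z) - S) o\<^sub>L R w))"])
  fix z assume z: "z \<in> \<Omega>"
  have "continuous_on \<Omega> (\<lambda>w. - (R z o\<^sub>L ((L (w + z) - S) o\<^sub>L R w)))"
    by (intro continuous_on_minus continuous_on_diff continuous_on_add continuous_on_id continuous_on_const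
        comp.continuous_on[of \<Omega>] continuous_on_L continuous_on_R)
  then show "isCont (\<lambda>w. - (R z o\<^sub>L ((L (w + z) - S) o\<^sub>L R w))) z"
    using z by (simp add: continuous_on_eq_continuous_at open_\<Omega>)
next
  show "continuous_on \<Omega> (\<lambda>z. - (R z o\<^sub>L ((L (z + z) - S) o\<^sub>L R z)))"
    by (intro continuous_on_minus continuous_on_diff continuous_on_add continuous_on_id continuous_on_const
        comp.continuous_on[of \<Omega>] continuous_on_L continuous_on_R)
qed (simp add: R_diff)

text \<open>Decay of second order is what outweighs the affine factor \<open>P\<close> in
  \<open>cycle_int_R\<close>.\<close>

lemma R_bound:
  obtains C b where "b \<ge> 1" "\<And>z. z \<in> \<Omega> \<Longrightarrow> norm z \<ge> b \<Longrightarrow> norm (R z) \<le> C / (norm z)\<^sup>2"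
proof -
  obtain K where "K > 0 \<and> (\<forall>a. norm (L a) \<le> norm a * K)"
    using L.pos_bounded ..
  then have K: "K > 0" "\<And>a. norm (L a) \<le> norm a * K" by auto
  \<comment> \<open>Solving Q R = 1 for z^2 R gives r \<le> K / x^2 + (c / x) r, where x \<ge> 1
    merges the term with \<open>N\<close> into the one with \<open>S\<close>. For x \<ge> 2 c at
    most half of r remains on the right, which explains the threshold and the constant
    \<open>2 * K\<close>.\<close>
  define c where "c = K * (K * norm S + norm N)"
  have c: "c \<ge> 0" using K by (simp add: c_def)
  show thesis
  proof (rule that[of "max 1 (2 * c)" "2 * K"])
    fix z assume z: "z \<in> \<Omega>" "max 1 (2 * c) \<le> norm z"
    define r x where "r = norm (R z)" and "x = norm z"
    have x: "x \<ge> 1" "2 * c \<le> x" using z by (auto simp: x_def)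
    have r0: "r \<ge> 0" by (simp add: r_def)
    have nz: "z \<noteq> 0" using x by (auto simp: x_def)
    have "L z o\<^sub>L (L z o\<^sub>L R z) = id_blinfun + ((L z o\<^sub>L (S o\<^sub>L R z)) - (N o\<^sub>L R z))"
      using RQ(2)[OF z(1)] by (simp add: Q_def comp_simps algebra_simps)
    then have "L (1 / z\<^sup>2) o\<^sub>L (L z o\<^sub>L (L z o\<^sub>L R z)) =
        L (1 / z\<^sup>2) o\<^sub>L (id_blinfun + ((L z o\<^sub>L (S o\<^sub>L R z)) - (N o\<^sub>L R z)))" by simp
    moreover have "L (1 / z\<^sup>2) o\<^sub>L (L z o\<^sub>L (L z o\<^sub>L R z)) = R z"
      using nz by (simp add: blinfun_compose_assoc[symmetric] L_mult[symmetric] power2_eq_square L_one)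
    ultimately have "r \<le> norm (L (1 / z\<^sup>2)) * norm (id_blinfun + ((L z o\<^sub>L (S o\<^sub>L R z)) - (N o\<^sub>L R z)))"
      unfolding r_def by (metis norm_blinfun_compose)
    also have "\<dots> \<le> (K / x\<^sup>2) * (1 + x * (K * norm S + norm N) * r)"
    proof (intro mult_mono)
      show "norm (L (1 / z\<^sup>2)) \<le> K / x\<^sup>2"
        using K(2)[of "1 / z\<^sup>2"] by (simp add: x_def norm_divide norm_power)
      have "norm (L z o\<^sub>L (S o\<^sub>L R z)) \<le> norm (L z) * (norm S * norm (R z))"
        by (rule order_trans[OF norm_blinfun_compose mult_left_mono[OF norm_blinfun_compose]]) simp
      also have "\<dots> \<le> (x * K) * (norm S * r)"
        using K(2)[of z] by (intro mult_mono) (auto simp: x_def r_def less_imp_le[OF K(1)])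
      finally have 1: "norm (L z o\<^sub>L (S o\<^sub>L R z)) \<le> x * (K * norm S) * r" by (simp add: mult_ac)
      have "norm (N o\<^sub>L R z) \<le> 1 * (norm N * r)" unfolding r_def using norm_blinfun_compose by simp
      also have "\<dots> \<le> x * (norm N * r)" using x r0 by (intro mult_right_mono) auto
      finally have 2: "norm (N o\<^sub>L R z) \<le> x * norm N * r" by (simp add: mult_ac)
      have "norm (id_blinfun + ((L z o\<^sub>L (S o\<^sub>L R z)) - (N o\<^sub>L R z)))
          \<le> norm (id_blinfun :: 'a \<Rightarrow>\<^sub>L 'a) + (norm (L z o\<^sub>L (S o\<^sub>L R z)) + norm (N o\<^sub>L R z))"
        by (rule order_trans[OF norm_triangle_ineq add_left_mono[OF norm_triangle_ineq4]])
      then show "norm (id_blinfun + ((L z o\<^sub>L (S o\<^sub>L R z)) - (N o\<^sub>L R z)))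
          \<le> 1 + x * (K * norm S + norm N) * r"
        using 1 2 norm_blinfun_id_le[where 'a = 'a] by (simp add: algebra_simps)
    qed (use K x in auto)
    also have "\<dots> = K / x\<^sup>2 + (c / x) * r"
      using x by (simp add: c_def field_simps power2_eq_square)
    also have "(c / x) * r \<le> (1 / 2) * r"
      using x r0 by (intro mult_right_mono) (auto simp: field_simps)
    finally show "norm (R z) \<le> 2 * K / (norm z)\<^sup>2" by (simp add: r_def x_def)
  qed simp
qed

section \<open>Moments of the resolvent over a cycle\<close>

lemma bounded_linear_mult_left: "bounded_linear (\<lambda>X. A o\<^sub>L X)"
  by (rule comp.bounded_linear_right)

text \<open>Q R = 1 reads w^2 R = S w R - N R + 1. Multiplied by w^k and integrated, the last term
  disappears because w^k is entire and the paths are closed.\<close>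

lemma cycle_int_pow:
  assumes gs: "cycle_in gs \<Omega>"
  shows "cycle_int gs (\<lambda>w. L (w ^ Suc (Suc k)) o\<^sub>L R w) =
    (S o\<^sub>L cycle_int gs (\<lambda>w. L (w ^ Suc k) o\<^sub>L R w)) - (N o\<^sub>L cycle_int gs (\<lambda>w. L (w ^ k) o\<^sub>L R w))"
proof -
  let ?f = "\<lambda>k w. L (w ^ k) o\<^sub>L R w"
  have hol: "hol_on (?f k) \<Omega>" for k
    by (intro hol_on_cs hol_on_R open_\<Omega> holomorphic_intros)
  have lin: "hol_on (\<lambda>w. A o\<^sub>L ?f k w) \<Omega>"
      "cycle_int gs (\<lambda>w. A o\<^sub>L ?f k w) = A o\<^sub>L cycle_int gs (?f k)"
    if "\<And>a. A o\<^sub>L L a = L a o\<^sub>L A" for A k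
  proof -
    have "A o\<^sub>L (L a o\<^sub>L X) = L a o\<^sub>L (A o\<^sub>L X)" for a and X :: "'a \<Rightarrow>\<^sub>L 'a"
      by (metis that blinfun_compose_assoc)
    then show "hol_on (\<lambda>w. A o\<^sub>L ?f k w) \<Omega>"
      "cycle_int gs (\<lambda>w. A o\<^sub>L ?f k w) = A o\<^sub>L cycle_int gs (?f k)"
      by (intro hol_on_linear[OF hol] cycle_int_linear[OF gs hol] bounded_linear_mult_left; assumption)+
  qed
  \<comment> \<open>The left factor \<open>- N\<close> and the trailing \<open>id_blinfun\<close>
    give each term the shape that \<open>cycle_int_linear\<close> or \<open>cycle_int_const\<close>
    accepts.\<close>
  have "cycle_int gs (?f (Suc (Suc k))) =
      cycle_int gs (\<lambda>w. ((S o\<^sub>L ?f (Suc k) w) + (- N o\<^sub>L ?f k w)) + (L (w ^ k) o\<^sub>L id_blinfun))"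
  proof (rule cycle_int_cong[OF gs])
    fix w assume w: "w \<in> \<Omega>"
    have "(L w o\<^sub>L (L w o\<^sub>L R w)) = (S o\<^sub>L (L w o\<^sub>L R w)) - (N o\<^sub>L R w) + id_blinfun"
      using RQ(2)[OF w] by (simp add: Q_def comp_simps SL_left algebra_simps)
    from arg_cong[OF this, of "\<lambda>X. L (w ^ k) o\<^sub>L X"]
    show "?f (Suc (Suc k)) w = ((S o\<^sub>L ?f (Suc k) w) + (- N o\<^sub>L ?f k w)) + (L (w ^ k) o\<^sub>L id_blinfun)"
      by (simp add: L_mult comp_simps SL_left NL_left L_commute_left)
  qed
  also have "\<dots> = cycle_int gs (\<lambda>w. S o\<^sub>L ?f (Suc k) w) + cycle_int gs (\<lambda>w. - N o\<^sub>L ?f k w)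
      + cycle_int gs (\<lambda>w. L (w ^ k) o\<^sub>L id_blinfun)"
  proof -
    have "hol_on (\<lambda>w. S o\<^sub>L ?f (Suc k) w) \<Omega>" "hol_on (\<lambda>w. - N o\<^sub>L ?f k w) \<Omega>"
      by (rule lin(1); simp add: SL NL comp_simps)+
    moreover have "hol_on (\<lambda>w. L (w ^ k) o\<^sub>L id_blinfun) \<Omega>"
      by (intro hol_on_cs hol_on_const open_\<Omega> holomorphic_intros)
    ultimately show ?thesis by (simp only: cycle_int_add[OF gs] hol_on_add)
  qed
  also have "cycle_int gs (\<lambda>w. L (w ^ k) o\<^sub>L id_blinfun) = 0"
  proof -
    have "contour_integral g (\<lambda>w. w ^ k) = 0" if "g \<in> set gs" for g
    proof (rule contour_integral_unique, rule Cauchy_theorem_convex_simple[of _ UNIV])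
      show "(\<lambda>w. w ^ k) holomorphic_on UNIV" by (intro holomorphic_intros)
    qed (use gs that in \<open>auto simp: cycle_in_def\<close>)
    then have "(\<Sum>g\<leftarrow>gs. contour_integral g (\<lambda>w. w ^ k)) = 0" by (simp cong: map_cong)
    then show ?thesis
      by (subst cycle_int_const[OF gs]) (auto intro!: holomorphic_intros simp: L.zero)
  qed
  also have "cycle_int gs (\<lambda>w. S o\<^sub>L ?f (Suc k) w) = S o\<^sub>L cycle_int gs (?f (Suc k))"
    by (rule lin(2)) (rule SL)
  also have "cycle_int gs (\<lambda>w. - N o\<^sub>L ?f k w) = - N o\<^sub>L cycle_int gs (?f k)"
    by (rule lin(2)) (simp add: comp_simps NL)
  finally show ?thesis by (simp only: comp.minus_left add_0_right diff_conv_add_uminus)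
qed

text \<open>\<open>V\<close> is the inside of the cycle. The function \<open>G\<close> never
  evaluates the Cauchy integral on a path: points of the paths lie in \<Omega> but not in
  \<open>V\<close>, where \<open>G\<close> is given by \<open>R z o\<^sub>L P z\<close>. The two
  formulas agree on the open overlap of \<open>V\<close> and \<Omega>, and these two sets cover the
  plane.\<close>

lemma cycle_int_R:
  assumes gs: "cycle_in gs \<Omega>"
    and V: "open V" "bounded V" "- \<Omega> \<subseteq> V" "\<And>g. g \<in> set gs \<Longrightarrow> V \<inter> path_image g = {}"
    and wind: "\<And>z. z \<in> V \<Longrightarrow> (\<Sum>g\<leftarrow>gs. winding_number g z) = 1"
  shows "cycle_int gs R = 0" "cycle_int gs (\<lambda>w. L w o\<^sub>L R w) = L (2 * pi * \<i>)"
proof -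
  define D E where "D = cycle_int gs R" and "E = cycle_int gs (\<lambda>w. L w o\<^sub>L R w)"
  \<comment> \<open>Dividing \<open>R_diff\<close> by w - z writes R(w)/(w - z) as R(z)/(w - z) -
    R(z) w R(w) - R(z) (z - S) R(w); the integrals of the three terms are those collected in R(z)
    P(z).\<close>
  define P where "P z = L (2 * pi * \<i>) - E - ((L z - S) o\<^sub>L D)" for z
  define h where "h z = cycle_int gs (\<lambda>w. L (1 / (w - z)) o\<^sub>L R w)" for z
  define G where "G z = (if z \<in> V then h z else R z o\<^sub>L P z)" for z
  have eq: "h z = R z o\<^sub>L P z" if z: "z \<in> V" "z \<in> \<Omega>" for z
  proof -
    \<comment> \<open>The point z lies in \<open>V\<close>, hence off all paths, so the pole of the
      kernel may be cut out of the domain.\<close>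
    have gs': "cycle_in gs (\<Omega> - {z})"
      using gs V(4) z open_\<Omega> unfolding cycle_in_def by blast
    have hol: "hol_on (\<lambda>w. L w o\<^sub>L R w) (\<Omega> - {z})" "hol_on R (\<Omega> - {z})"
      using hol_on_R hol_on_cs[OF _ hol_on_R open_\<Omega>, of "\<lambda>w. w"]
      by (auto intro: hol_on_subset holomorphic_intros)
    have A: "- R z o\<^sub>L (L a o\<^sub>L X) = L a o\<^sub>L (- R z o\<^sub>L X)"
      for a and X :: "'a \<Rightarrow>\<^sub>L 'a"
      by (simp add: comp_simps R_commute_left[OF z(2)])
    have B: "(- R z o\<^sub>L (L z - S)) o\<^sub>L (L a o\<^sub>L X) = L a o\<^sub>L ((- R z o\<^sub>L (L z - S)) o\<^sub>L X)"
      for a and X :: "'a \<Rightarrow>\<^sub>L 'a"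
      using A[of a] by (simp add: comp_simps SL_left L_commute_left[of z a])
    have c: "hol_on (\<lambda>w. L (1 / (w - z)) o\<^sub>L R z) (\<Omega> - {z})"
      using open_\<Omega> by (intro hol_on_cs hol_on_const holomorphic_intros) auto
    have "h z = cycle_int gs (\<lambda>w. ((L (1 / (w - z)) o\<^sub>L R z) + (- R z o\<^sub>L (L w o\<^sub>L R w)))
        + ((- R z o\<^sub>L (L z - S)) o\<^sub>L R w))"
      unfolding h_def
    proof (rule cycle_int_cong[OF gs'])
      fix w assume w: "w \<in> \<Omega> - {z}"
      have "L (1 / (w - z)) o\<^sub>L (R w - R z) =
          (L (1 / (w - z)) o\<^sub>L L (w - z)) o\<^sub>L - (R z o\<^sub>L ((L (w + z) - S) o\<^sub>L R w))"
        using R_diff[of z w] w z by (simp add: blinfun_compose_assoc)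
      also have "L (1 / (w - z)) o\<^sub>L L (w - z) = id_blinfun"
        using w by (simp add: L_mult[symmetric] L_one)
      finally show "L (1 / (w - z)) o\<^sub>L R w = ((L (1 / (w - z)) o\<^sub>L R z) + (- R z o\<^sub>L (L w o\<^sub>L R w)))
          + ((- R z o\<^sub>L (L z - S)) o\<^sub>L R w)"
        by (simp add: comp_simps L.add algebra_simps)
    qed
    also have "\<dots> = cycle_int gs (\<lambda>w. L (1 / (w - z)) o\<^sub>L R z) + cycle_int gs (\<lambda>w. - R z o\<^sub>L (L w o\<^sub>L R w))
        + cycle_int gs (\<lambda>w. (- R z o\<^sub>L (L z - S)) o\<^sub>L R w)"
      using c hol_on_linear[OF hol(1) bounded_linear_mult_left A]
        hol_on_linear[OF hol(2) bounded_linear_mult_left B]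
      by (simp add: cycle_int_add[OF gs'] hol_on_add)
    also have "cycle_int gs (\<lambda>w. - R z o\<^sub>L (L w o\<^sub>L R w)) = - R z o\<^sub>L E"
      unfolding E_def by (rule cycle_int_linear[OF gs' hol(1) bounded_linear_mult_left A])
    also have "cycle_int gs (\<lambda>w. (- R z o\<^sub>L (L z - S)) o\<^sub>L R w) = (- R z o\<^sub>L (L z - S)) o\<^sub>L D"
      unfolding D_def by (rule cycle_int_linear[OF gs' hol(2) bounded_linear_mult_left B])
    also have "cycle_int gs (\<lambda>w. L (1 / (w - z)) o\<^sub>L R z) = L (2 * pi * \<i>) o\<^sub>L R z"
    proof -
      have "contour_integral g (\<lambda>w. 1 / (w - z)) = 2 * pi * \<i> * winding_number g z" if "g \<in> set gs" for g
        using winding_number_valid_path[of g z] gs' that unfolding cycle_in_def by force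
      then have "(\<Sum>g\<leftarrow>gs. contour_integral g (\<lambda>w. 1 / (w - z))) = 2 * pi * \<i> * (\<Sum>g\<leftarrow>gs. winding_number g z)"
        by (simp add: sum_list_const_mult cong: map_cong)
      then show ?thesis
        using wind[OF z(1)] by (subst cycle_int_const[OF gs']) (auto intro!: holomorphic_intros)
    qed
    finally show ?thesis by (simp add: P_def comp_simps R_commute[OF z(2)] R_commute_left[OF z(2)])
  qed
  have "hol_on h V"
    unfolding h_def[abs_def] cycle_int_def
  proof (rule hol_on_sum_list)
    fix g assume "g \<in> set gs"
    then show "hol_on (\<lambda>z. path_int g (\<lambda>w. L (1 / (w - z)) o\<^sub>L R w)) V"
      using gs V unfolding cycle_in_def
      by (intro hol_on_cauchy_integral[OF _ _ open_\<Omega> hol_on_R]) auto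
  qed
  then have "hol_on G V" by (rule hol_on_cong[OF _ V(1)]) (simp add: G_def)
  have "hol_on (\<lambda>z. R z o\<^sub>L P z) \<Omega>"
  proof -
    \<comment> \<open>The z inside \<open>P\<close> is moved to the left of \<open>R z\<close> as a
      scalar. What remains on the right of \<open>R z\<close> is constant, so each summand is a
      scalar multiple of a linear image of \<open>R\<close>.\<close>
    have "hol_on (\<lambda>z. (R z o\<^sub>L (L (2 * pi * \<i>) - E + (S o\<^sub>L D))) + (L (- z) o\<^sub>L (R z o\<^sub>L D))) \<Omega>"
      by (intro hol_on_add hol_on_cs holomorphic_intros open_\<Omega> hol_on_linear[OF hol_on_R]
          comp.bounded_linear_left) (simp_all add: blinfun_compose_assoc)
    then show ?thesis
    proof (rule hol_on_cong[OF _ open_\<Omega>])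
      fix z assume z: "z \<in> \<Omega>"
      show "(R z o\<^sub>L (L (2 * pi * \<i>) - E + (S o\<^sub>L D))) + (L (- z) o\<^sub>L (R z o\<^sub>L D)) = R z o\<^sub>L P z"
        by (simp add: P_def comp_simps L.neg R_commute_left[OF z])
    qed
  qed
  then have "hol_on G \<Omega>" by (rule hol_on_cong[OF _ open_\<Omega>]) (simp add: G_def eq)
  have hol: "hol_on G UNIV"
  proof -
    have "V \<union> \<Omega> = UNIV" using V(3) by auto
    then show ?thesis using hol_on_Un[OF _ _ V(1) open_\<Omega>] \<open>hol_on G V\<close> \<open>hol_on G \<Omega>\<close> by metis
  qed
  obtain c b where b: "b \<ge> 1" "\<And>z. z \<in> \<Omega> \<Longrightarrow> norm z \<ge> b \<Longrightarrow> norm (R z) \<le> c / (norm z)\<^sup>2"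
    by (rule R_bound) blast
  obtain K where "K > 0 \<and> (\<forall>a. norm (L a) \<le> norm a * K)" using L.pos_bounded ..
  then have K: "K > 0" "\<And>a. norm (L a) \<le> norm a * K" by auto
  obtain B where B: "\<And>z. z \<in> V \<Longrightarrow> norm z \<le> B" using V(2) unfolding bounded_iff by blast
  \<comment> \<open>Beyond this radius the bound on \<open>R\<close> holds and \<open>V\<close> has
    been left; the 1 makes the latter strict.\<close>
  define r where "r = max b (B + 1)"
  have far: "z \<in> \<Omega>" "z \<notin> V" if "norm z \<ge> r" for z
    using that B[of z] V(3) by (auto simp: r_def)
  define k where "k = norm (L (2 * pi * \<i>) - E + (S o\<^sub>L D))"
  have "(G \<longlongrightarrow> 0) at_infinity"
  proof (rule Lim_null_comparison)
    show "\<forall>\<^sub>F z in at_infinity. norm (G z) \<le> c * k * (inverse (norm z))\<^sup>2 + c * K * norm D * inverse (norm z)"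
      unfolding eventually_at_infinity
    proof (intro exI[of _ r] allI impI)
      fix z :: complex assume z: "r \<le> norm z"
      have "norm z \<ge> b" using z by (simp add: r_def)
      then have z0: "norm z > 0" using b(1) by linarith
      have bz: "norm (R z) \<le> c / (norm z)\<^sup>2" using b(2)[OF far(1)[OF z]] z by (simp add: r_def)
      have "P z = (L (2 * pi * \<i>) - E + (S o\<^sub>L D)) - (L z o\<^sub>L D)" by (simp add: P_def comp_simps)
      then have "norm (P z) \<le> k + norm (L z o\<^sub>L D)" unfolding k_def by (metis norm_triangle_ineq4)
      also have "norm (L z o\<^sub>L D) \<le> norm z * K * norm D"
        by (rule order_trans[OF norm_blinfun_compose mult_right_mono[OF K(2)]]) simp
      finally have P: "norm (P z) \<le> k + norm z * K * norm D" by simp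
      have "norm (G z) \<le> norm (R z) * norm (P z)"
        using far(2)[OF z] by (simp add: G_def norm_blinfun_compose)
      also have "\<dots> \<le> c / (norm z)\<^sup>2 * (k + norm z * K * norm D)"
        by (rule mult_mono[OF bz P]) (use order_trans[OF norm_ge_zero bz] in auto)
      also have "\<dots> = c * k * (inverse (norm z))\<^sup>2 + c * K * norm D * inverse (norm z)"
        using z0 by (simp add: field_simps power2_eq_square)
      finally show "norm (G z) \<le> \<dots>" .
    qed
    have "((\<lambda>z :: complex. inverse (norm z)) \<longlongrightarrow> 0) at_infinity"
      by (rule tendsto_inverse_0_at_top[OF filterlim_norm_at_top])
    then have "((\<lambda>z :: complex. c * k * (inverse (norm z))\<^sup>2 + c * K * norm D * inverse (norm z)) \<longlongrightarrow>
        c * k * 0\<^sup>2 + c * K * norm D * 0) at_infinity"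
      by (intro tendsto_intros)
    then show "((\<lambda>z :: complex. c * k * (inverse (norm z))\<^sup>2 + c * K * norm D * inverse (norm z)) \<longlongrightarrow> 0) at_infinity"
      by simp
  qed
  with hol have G: "G z = 0" for z by (rule liouville)
  have P: "P z = 0" if "norm z \<ge> r" for z
  proof -
    have "R z o\<^sub>L P z = 0" using G[of z] far(2)[OF that] by (simp add: G_def)
    then have "Q z o\<^sub>L (R z o\<^sub>L P z) = 0" by simp
    then show ?thesis by (simp add: blinfun_compose_assoc[symmetric] RQ(2) far(1)[OF that])
  qed
  have "r \<ge> 1" using b by (simp add: r_def)
  \<comment> \<open>Two points suffice for an affine function: its values at r and r + 1 differ by
    D, and once D = 0 the constant term gives E.\<close>
  then have "P (of_real r) = 0" "P (of_real (r + 1)) = 0" by (intro P; simp)+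
  then have "P (of_real r) - P (of_real r + 1) = 0" by simp
  then have D: "D = 0"
    by (simp add: P_def comp_simps L.add L_one)
  with \<open>P (of_real r) = 0\<close> have "E = L (2 * pi * \<i>)" by (simp add: P_def)
  with D show "cycle_int gs R = 0" "cycle_int gs (\<lambda>w. L w o\<^sub>L R w) = L (2 * pi * \<i>)"
    by (simp_all add: D_def E_def)
qed

text \<open>The moments and the operators H obey the same two-term recursion. The exponent exceeds
  the index of H by one because the moment of order 0 vanishes and thus plays the part of H at index
  -1. The operators H enter through the recursion alone.\<close>

lemma cycle_int_moment:
  assumes gs: "cycle_in gs \<Omega>"
    and V: "open V" "bounded V" "- \<Omega> \<subseteq> V" "\<And>g. g \<in> set gs \<Longrightarrow> V \<inter> path_image g = {}"
    and wind: "\<And>z. z \<in> V \<Longrightarrow> (\<Sum>g\<leftarrow>gs. winding_number g z) = 1"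
    and H: "H 0 = id_blinfun" "H 1 = S" "\<And>k. H (Suc (Suc k)) = (S o\<^sub>L H (Suc k)) - (N o\<^sub>L H k)"
  shows "cycle_int gs (\<lambda>w. L (w ^ Suc m) o\<^sub>L R w) = L (2 * pi * \<i>) o\<^sub>L H m"
proof -
  note I = cycle_int_R[OF gs V wind] and rec = cycle_int_pow[OF gs]
  show ?thesis
  proof (induction m rule: less_induct)
    case (less m)
    consider "m = 0" | "m = 1" | k where "m = Suc (Suc k)" by (metis One_nat_def not0_implies_Suc)
    then show ?case
    proof cases
      case 1
      then show ?thesis using I(2) H(1) by simp
    next
      \<comment> \<open>The recursion at k = 0 reads S E - N D, and D = 0.\<close>
      case 2
      then show ?thesis using rec[of 0] I H(2) by (simp add: L_one SL)
    next
      case 3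
      then show ?thesis
        using rec[of "Suc k"] less[of k] less[of "Suc k"] H(3)[of k]
        by (simp add: comp_simps SL_left NL_left)
    qed
  qed
qed

end

section \<open>Slices of the quaternionic operator\<close>

text \<open>Without boundedness and linearity the \<open>Blinfun\<close> in \<open>opact\<close>
  would carry no information about its argument.\<close>

lemma bounded_linear_qprod_blinfun: "bounded_linear (qprod blinfun_apply T)"
proof -
  obtain T0 T1 T2 T3 where T: "T = (T0, T1, T2, T3)" by (cases T) auto
  have "bounded_linear (\<lambda>x. qprod blinfun_apply T x)"
    unfolding T qprod_def split_beta fst_conv snd_conv
    by (intro bounded_linear_Pair bounded_linear_add bounded_linear_sub
        bounded_linear_compose[OF blinfun.bounded_linear_right]
        bounded_linear_fst bounded_linear_snd bounded_linear_fst_comp bounded_linear_snd_comp bounded_linear_ident)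
  then show ?thesis .
qed

lemma opact_apply: "blinfun_apply (opact T) = qprod blinfun_apply T"
  unfolding opact_def by (rule bounded_linear_Blinfun_apply[OF bounded_linear_qprod_blinfun])

lemma lmult_apply:
  "blinfun_apply (lmult q :: 'x::real_normed_vector qmod \<Rightarrow>\<^sub>L 'x qmod) = qprod scaleR q"
proof -
  obtain q0 q1 q2 q3 where q: "q = (q0, q1, q2, q3)" by (cases q) auto
  \<comment> \<open>A quaternion acts like the operator quadruple of its real coordinates times the
    identity, so boundedness is inherited from the case of \<open>opact\<close>.\<close>
  define I where "I = (id_blinfun :: 'x \<Rightarrow>\<^sub>L 'x)"
  have eq: "qprod scaleR q = qprod blinfun_apply (q0 *\<^sub>R I, q1 *\<^sub>R I, q2 *\<^sub>R I, q3 *\<^sub>R I)"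
    by (simp add: fun_eq_iff q qprod_def blinfun.scaleR_left I_def)
  show ?thesis
    unfolding lmult_def eq by (rule bounded_linear_Blinfun_apply[OF bounded_linear_qprod_blinfun])
qed

lemma blinfun_eqI4:
  assumes "\<And>a b c d. blinfun_apply A (a, b, c, d) = blinfun_apply B (a, b, c, d)"
  shows "A = B"
  using assms by (intro blinfun_eqI) (auto simp: split_paired_all)

lemma lmult_qmult: "lmult (qmult p q) = lmult p o\<^sub>L lmult q"
  by (cases p, cases q, rule blinfun_eqI4)
    (simp add: lmult_apply qmult_def qprod_def algebra_simps)

lemma lmult_qone: "lmult qone = id_blinfun"
  by (rule blinfun_eqI4) (simp add: lmult_apply qone_def qprod_def)

lemma lmult_add: "lmult (p + q) = lmult p + lmult q"
  by (cases p, cases q, rule blinfun_eqI4)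
    (simp add: lmult_apply qprod_def blinfun.add_left algebra_simps)

lemma lmult_scaleR: "lmult (r *\<^sub>R q) = r *\<^sub>R lmult q"
  by (cases q, rule blinfun_eqI4)
    (simp add: lmult_apply qprod_def blinfun.scaleR_left algebra_simps)

lemma cJ_mult:
  assumes "J \<in> imag_units"
  shows "qmult (cJ J a) (cJ J b) = cJ J (a * b)"
proof -
  obtain i j k where J: "J = (0, i, j, k)" and "i\<^sup>2 + j\<^sup>2 + k\<^sup>2 = 1"
    using assms by (auto simp: imag_units_def)
  \<comment> \<open>In the product J contributes its square, that is minus the sum of squares of i,
    j, k. The relation is brought into nested form so that it matches the expanded real
    part.\<close>
  then have "x = (i\<^sup>2 + j\<^sup>2 + k\<^sup>2) * x" for x by simp
  then have "x = i * (i * x) + (j * (j * x) + k * (k * x))" for x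
    by (simp only: power2_eq_square distrib_right mult.assoc add.assoc)
  from this[of "Im a * Im b"] show ?thesis
    by (simp add: J qmult_def qprod_def cJ_def algebra_simps)
qed

lemma cJ_1: "cJ J 1 = qone"
  by (simp add: cJ_def qone_def)

lemma cJ_minus_ii: "J \<in> imag_units \<Longrightarrow> cJ J (- \<i>) = - J"
  by (auto simp: cJ_def imag_units_def zero_prod_def[symmetric])

lemma qpow_cJ: "J \<in> imag_units \<Longrightarrow> qpow (cJ J z) n = cJ J (z ^ n)"
  by (induction n) (simp_all add: qpow_def cJ_1 cJ_mult)

lemma bounded_linear_lmult_cJ: "bounded_linear (\<lambda>z. lmult (cJ J z))"
  \<comment> \<open>The complex plane has finite real dimension, so linearity already implies
    boundedness.\<close>
  unfolding linear_conv_bounded_linear[symmetric]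
proof (rule linearI)
  show "lmult (cJ J (a + b)) = lmult (cJ J a) + lmult (cJ J b)" for a b
    by (subst lmult_add[symmetric], cases J) (simp add: cJ_def algebra_simps)
  show "lmult (cJ J (r *\<^sub>R a)) = r *\<^sub>R lmult (cJ J a)" for r a
    by (subst lmult_scaleR[symmetric], cases J) (simp add: cJ_def algebra_simps)
qed

lemma continuous_on_cJ: "continuous_on UNIV (cJ J)"
  unfolding cJ_def[abs_def] by (intro continuous_intros)

text \<open>The imaginary units cancel, leaving one real operator repeated in all four coordinates;
  this is why the sum commutes with left multiplication by quaternions.\<close>

lemma opact_add_conjop_apply:
  "blinfun_apply (opact (T0, T1, T2, T3) + opact (conjop (T0, T1, T2, T3))) (x0, x1, x2, x3) =
    (2 *\<^sub>R T0 x0, 2 *\<^sub>R T0 x1, 2 *\<^sub>R T0 x2, 2 *\<^sub>R T0 x3)"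
  by (simp add: blinfun.add_left blinfun.minus_left opact_apply conjop_def qprod_def scaleR_2)

context
  fixes T :: "'x::banach qop"
  assumes BC: "in_BC T"
begin

text \<open>Here the commutativity of the components enters: the mixed terms cancel in pairs and a
  diagonal action of the sum of squares is left, the same for both orders of the factors.\<close>

lemma opact_conjop_apply:
  assumes "T = (T0, T1, T2, T3)"
  shows "opact T (opact (conjop T) (x0, x1, x2, x3)) =
    (let N = (T0 o\<^sub>L T0) + (T1 o\<^sub>L T1) + (T2 o\<^sub>L T2) + (T3 o\<^sub>L T3) in (N x0, N x1, N x2, N x3))"
    and "opact (conjop T) (opact T (x0, x1, x2, x3)) =
    (let N = (T0 o\<^sub>L T0) + (T1 o\<^sub>L T1) + (T2 o\<^sub>L T2) + (T3 o\<^sub>L T3) in (N x0, N x1, N x2, N x3))"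
proof -
  have "A (B x) = B (A x)" if "A \<in> {T0, T1, T2, T3}" "B \<in> {T0, T1, T2, T3}" for A B x
  proof -
    have "A o\<^sub>L B = B o\<^sub>L A" using BC that unfolding in_BC_def assms by blast
    then show ?thesis by (metis blinfun_apply_blinfun_compose)
  qed
  then have c: "T1 (T0 x) = T0 (T1 x)" "T2 (T0 x) = T0 (T2 x)" "T3 (T0 x) = T0 (T3 x)"
    "T2 (T1 x) = T1 (T2 x)" "T3 (T1 x) = T1 (T3 x)" "T3 (T2 x) = T2 (T3 x)" for x
    by simp_all
  show "opact T (opact (conjop T) (x0, x1, x2, x3)) =
    (let N = (T0 o\<^sub>L T0) + (T1 o\<^sub>L T1) + (T2 o\<^sub>L T2) + (T3 o\<^sub>L T3) in (N x0, N x1, N x2, N x3))"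
    "opact (conjop T) (opact T (x0, x1, x2, x3)) =
    (let N = (T0 o\<^sub>L T0) + (T1 o\<^sub>L T1) + (T2 o\<^sub>L T2) + (T3 o\<^sub>L T3) in (N x0, N x1, N x2, N x3))"
    unfolding assms
    by (simp_all add: Let_def opact_apply conjop_def qprod_def blinfun.bilinear_simps c)
qed

lemma opact_conjop_commute:
  "opact T o\<^sub>L opact (conjop T) = opact (conjop T) o\<^sub>L opact T"
proof (rule blinfun_eqI)
  fix x :: "'x qmod"
  obtain T0 T1 T2 T3 x0 x1 x2 x3 where "T = (T0, T1, T2, T3)" "x = (x0, x1, x2, x3)"
    by (cases T, cases x) auto
  then show "(opact T o\<^sub>L opact (conjop T)) x = (opact (conjop T) o\<^sub>L opact T) x"
    using opact_conjop_apply[of T0 T1 T2 T3] by simp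
qed

lemma quadratic_pencil_opact:
  assumes J: "J \<in> imag_units"
  shows "quadratic_pencil (\<lambda>z. lmult (cJ J z)) (opact T + opact (conjop T)) (opact T o\<^sub>L opact (conjop T))"
proof (rule quadratic_pencil.intro)
  obtain T0 T1 T2 T3 where T: "T = (T0, T1, T2, T3)" by (cases T) auto
  show "lmult (cJ J 1) = id_blinfun" by (simp add: cJ_1 lmult_qone)
  show "lmult (cJ J (a * b)) = lmult (cJ J a) o\<^sub>L lmult (cJ J b)" for a b
    using J by (simp add: cJ_mult[symmetric] lmult_qmult)
  show "(opact T + opact (conjop T)) o\<^sub>L lmult (cJ J a) = lmult (cJ J a) o\<^sub>L (opact T + opact (conjop T))" for a
    unfolding T
    by (cases "cJ J a", rule blinfun_eqI4)
      (simp add: lmult_apply qprod_def opact_add_conjop_apply blinfun.add_right blinfun.diff_right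
        blinfun.scaleR_right scaleR_add_right scaleR_diff_right mult.commute)
  show "(opact T o\<^sub>L opact (conjop T)) o\<^sub>L lmult (cJ J a) = lmult (cJ J a) o\<^sub>L (opact T o\<^sub>L opact (conjop T))" for a
    by (cases "cJ J a", rule blinfun_eqI4)
      (simp add: lmult_apply qprod_def opact_conjop_apply[OF T] Let_def blinfun.bilinear_simps
        algebra_simps)
qed (rule bounded_linear_lmult_cJ)

text \<open>With A for T and B for its conjugate, H(k+1) = A H(k) + B^(k+1). Hence B^(k+2) = B
  (H(k+1) - A H(k)), and inserting this into the next such equation eliminates the pure
  powers.\<close>

lemma Hm_rec:
  "Hm T 0 = id_blinfun" "Hm T 1 = opact T + opact (conjop T)"
  "Hm T (Suc (Suc k)) = ((opact T + opact (conjop T)) o\<^sub>L Hm T (Suc k))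
    - ((opact T o\<^sub>L opact (conjop T)) o\<^sub>L Hm T k)"
proof -
  define A B where "A = opact T" and "B = opact (conjop T)"
  have AB: "A o\<^sub>L B = B o\<^sub>L A" unfolding A_def B_def by (rule opact_conjop_commute)
  have H0: "Hm T 0 = id_blinfun" by (simp add: Hm_def)
  have HS: "Hm T (Suc k) = (A o\<^sub>L Hm T k) + bpow B (Suc k)" for k
  proof -
    have "(\<Sum>i=0..k. bpow A (Suc k - i) o\<^sub>L bpow B i) = (\<Sum>i=0..k. A o\<^sub>L (bpow A (k - i) o\<^sub>L bpow B i))"
      by (intro sum.cong) (auto simp: Suc_diff_le bpow_Suc blinfun_compose_assoc)
    then show ?thesis
      by (simp add: Hm_def A_def[symmetric] B_def[symmetric] comp.sum_right)
  qed
  show "Hm T 0 = id_blinfun" "Hm T 1 = opact T + opact (conjop T)"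
    using H0 HS[of 0] by (simp_all add: A_def B_def bpow_Suc)
  have "bpow B (Suc (Suc k)) = B o\<^sub>L (Hm T (Suc k) - (A o\<^sub>L Hm T k))"
    by (simp add: HS[of k] bpow_Suc)
  then have "Hm T (Suc (Suc k)) = ((A + B) o\<^sub>L Hm T (Suc k)) - ((B o\<^sub>L A) o\<^sub>L Hm T k)"
    unfolding HS[of "Suc k"] by (simp only: comp_simps add_diff_eq)
  then show "Hm T (Suc (Suc k)) = ((opact T + opact (conjop T)) o\<^sub>L Hm T (Suc k))
    - ((opact T o\<^sub>L opact (conjop T)) o\<^sub>L Hm T k)"
    unfolding AB[symmetric] by (simp only: A_def B_def)
qed

end

section \<open>The moment formula transferred to a slice\<close>

theorem theorem8p1:
  fixes T :: "'x::banach qop" and m :: nat and U :: "quat set"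
  assumes "in_BC T"
    and "bounded U" and "slice_cauchy_domain U"
    and "S_spectrum T \<subseteq> U"
  shows "\<forall>J\<in>imag_units. \<forall>gs. pos_oriented_boundary J U gs \<longrightarrow>
           (\<forall>g\<in>set gs. slice_integrand T m J g integrable_on {0..1}) \<and>
           Hm T m = (1 / (2 * pi)) *\<^sub>R
             (\<Sum>g\<leftarrow>gs. integral {0..1} (slice_integrand T m J g))"
proof (intro ballI allI impI)
  fix J gs assume J: "J \<in> imag_units" and gs: "pos_oriented_boundary J U gs"
  define L where "L z = (lmult (cJ J z) :: 'x qmod \<Rightarrow>\<^sub>L 'x qmod)" for z
  define S where "S = opact T + opact (conjop T)"
  define N where "N = opact T o\<^sub>L opact (conjop T)"
  interpret quadratic_pencil L S N
    using quadratic_pencil_opact[OF assms(1) J] by (simp add: L_def[abs_def] S_def N_def)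
  have Q: "Qcs T (cJ J z) = Q z" for z
    by (simp only: Qcs_def Q_def lmult_qmult S_def[symmetric] N_def[symmetric] L_def)
  have R: "Qinv T (cJ J z) = R z" for z
    by (simp add: Qinv_def R_def inverse_pair_def Q)
  have \<Omega>: "z \<in> \<Omega> \<longleftrightarrow> cJ J z \<notin> S_spectrum T" for z
    by (simp add: \<Omega>_def S_spectrum_def inverse_pair_def Q)
  define V where "V = slice_set J U"
  have "open U" using assms(3) by (simp add: slice_cauchy_domain_def)
  then have V1: "open V" unfolding V_def slice_set_def by (rule open_vimage[OF _ continuous_on_cJ])
  have V2: "bounded V"
  proof -
    obtain b where b: "\<And>q. q \<in> U \<Longrightarrow> norm q \<le> b" using assms(2) unfolding bounded_iff by blast
    have "norm z \<le> b" if "z \<in> V" for z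
    proof -
      \<comment> \<open>J is a unit vector orthogonal to the real axis, so \<open>cJ J\<close>
        preserves norms and boundedness of U passes to its slice.\<close>
      have "norm (cJ J z) = norm z"
        using J by (auto simp: cJ_def imag_units_def norm_prod_def cmod_def power_mult_distrib
            simp flip: distrib_left)
      then show ?thesis using b[of "cJ J z"] that by (simp add: V_def slice_set_def)
    qed
    then show ?thesis unfolding bounded_iff by blast
  qed
  have V3: "- \<Omega> \<subseteq> V" using assms(4) \<Omega> by (auto simp: V_def slice_set_def)
  have gs': "valid_path g" "pathfinish g = pathstart g" "path_image g \<subseteq> frontier V"
    if "g \<in> set gs" for g
    using gs that unfolding pos_oriented_boundary_def jordan_boundary_def V_def by auto
  \<comment> \<open>An open set misses its frontier, so the paths avoid \<open>V\<close>. As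
    \<open>V\<close> contains all spectral points of the slice, the paths run in \<Omega>.\<close>
  have fr: "V \<inter> frontier V = {}" using V1 by (auto simp: frontier_def interior_open)
  have cyc: "cycle_in gs \<Omega>"
    unfolding cycle_in_def using open_\<Omega> gs' V3 fr by blast
  have V4: "V \<inter> path_image g = {}" if "g \<in> set gs" for g using gs'(3)[OF that] fr by blast
  have wind: "(\<Sum>g\<leftarrow>gs. winding_number g z) = 1" if "z \<in> V" for z
    using gs that fr unfolding pos_oriented_boundary_def V_def[symmetric] by auto
  let ?F = "\<lambda>w. L (w ^ Suc m) o\<^sub>L R w"
  have hol: "hol_on ?F \<Omega>" by (intro hol_on_cs hol_on_R open_\<Omega> holomorphic_intros)
  have integ: "(slice_integrand T m J g has_integral L (- \<i>) o\<^sub>L path_int g ?F) {0..1}"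
    if g: "g \<in> set gs" for g
  proof (rule has_integral_eq)
    show "((\<lambda>t. L (- \<i>) o\<^sub>L (L (vector_derivative g (at t)) o\<^sub>L ?F (g t))) has_integral
        L (- \<i>) o\<^sub>L path_int g ?F) {0..1}"
      using has_integral_linear[OF has_integral_path_int[OF _ _ open_\<Omega> hol] bounded_linear_mult_left] cyc g
      unfolding cycle_in_def o_def by blast
    fix t :: real assume "t \<in> {0..1}"
    then have t: "g t \<in> \<Omega>" using cyc g unfolding cycle_in_def path_image_def by blast
    \<comment> \<open>The factor - J of the measure is the slice element
      \<open>cJ J (- \<i>)\<close>. Slice scalars commute with each other and with R, so it can be
      moved to the far left and out of the integral.\<close>
    have "slice_integrand T m J g t =
        R (g t) o\<^sub>L L (vector_derivative g (at t) * - \<i> * g t ^ Suc m)"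
      by (simp only: slice_integrand_def R L_def cJ_minus_ii[OF J, symmetric] qpow_cJ[OF J] cJ_mult[OF J])
    also have "\<dots> = L (- \<i>) o\<^sub>L (L (vector_derivative g (at t)) o\<^sub>L ?F (g t))"
      by (simp only: R_commute[OF t] R_commute_left[OF t] L_mult blinfun_compose_assoc L_commute_left)
    finally show "L (- \<i>) o\<^sub>L (L (vector_derivative g (at t)) o\<^sub>L ?F (g t)) = slice_integrand T m J g t" ..
  qed
  have "(\<Sum>g\<leftarrow>gs. integral {0..1} (slice_integrand T m J g)) = (\<Sum>g\<leftarrow>gs. L (- \<i>) o\<^sub>L path_int g ?F)"
    by (intro arg_cong[of _ _ sum_list] map_cong refl integral_unique integ)
  also have "\<dots> = L (- \<i>) o\<^sub>L cycle_int gs ?F"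
    unfolding cycle_int_def by (induction gs) (simp_all add: comp_simps)
  also have "cycle_int gs ?F = L (2 * pi * \<i>) o\<^sub>L Hm T m"
    by (rule cycle_int_moment[OF cyc V1 V2 V3 V4 wind])
      (simp_all only: Hm_rec[OF assms(1)] S_def N_def)
  also have "L (- \<i>) o\<^sub>L (L (2 * pi * \<i>) o\<^sub>L Hm T m) = L (of_real (2 * pi)) o\<^sub>L Hm T m"
    by (simp add: blinfun_compose_assoc[symmetric] L_mult[symmetric] mult.commute)
  also have "\<dots> = (2 * pi) *\<^sub>R Hm T m"
    using L.scaleR[of "2 * pi" 1] by (simp add: L_one comp.scaleR_left of_real_def)
  finally show "(\<forall>g\<in>set gs. slice_integrand T m J g integrable_on {0..1}) \<and>
      Hm T m = (1 / (2 * pi)) *\<^sub>R (\<Sum>g\<leftarrow>gs. integral {0..1} (slice_integrand T m J g))"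
    using integ by (auto simp: integrable_on_def)
qed

end
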